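(* For the asymptotic competitive ratio of the full-information contextual blocking bandits problem with maximum delay $d_{\max}$ (a fixed positive integer), it holds that $$\lim_{T\to+\infty}\ \sup_{\pi}\ \rho^{\pi}(T)\ \le\ \frac{d_{\max}}{2d_{\max}-1},$$ where the supremum is over all (possibly randomized) online algorithms $\pi$ and $\rho^\pi(T)$ is the competitive ratio of $\pi$ for time horizon $T$ over instances with maximum delay $d_{\max}$.
   Context: Instance $I$. $\mathcal A$ is a finite set of arms, $\mathcal C$ a finite set of contexts. In each round $t=1,\dots,T$ a context $C_t\in\mathcal C$ is drawn independently, $C_t=j$ with probability $f_j$, $\sum_j f_j=1$. The player observes $C_t$ and then plays at most one available arm. If arm $i$ is played at round $t$ under context $j$ the player receives reward $X_{i,j,t}$; for each $(i,j)$ the variables $X_{i,j,t}$ are i.i.d. over $t$, with values in $[0,1]$ and mean $\mu_{i,j}$, and independent of contexts and of the player's randomness. Each arm $i$ has a delay $d_i\in\mathbb N$, $d_i\ge 1$: if $i$ is played at round $t$ it is unavailable during the next $d_i-1$ rounds. All arms are available at round 1. The maximum delay of the instance is $\max_i d_i$. Full-information online algorithm: it knows $\{f_j\},\{d_i\},\{\mu_{i,j}\}$, and at each round chooses an available arm (or skips), possibly at random, after observing the context of that round, without any knowledge of the realizations of future contexts. For an algorithm $\pi$ playing $A^\pi_t\in\mathcal A\cup\{\emptyset\}$ at round $t$, $\mathbf{Rew}^\pi_I(T)=\mathbb E\big[\sum_{t=1}^T\sum_{i,j}X_{i,j,t}\,\mathbb I(A^\pi_t=i,C_t=j)\big]$.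 $\mathbf{Rew}^*_I(T)$ is the expected reward of an optimal clairvoyant algorithm, which knows in advance the realizations of the contexts of all rounds $1,\dots,T$ (but not the reward realizations); equivalently, the expectation over the context sequence of the maximum over feasible schedules $(A_t)_{t\le T}$ (respecting the delays) of $\sum_{t:A_t\neq\emptyset}\mu_{A_t,C_t}$. The competitive ratio is $\rho^\pi(T)=\inf_I \mathbf{Rew}^\pi_I(T)/\mathbf{Rew}^*_I(T)$, the infimum being over instances $I$ with maximum delay $d_{\max}$ (and $\mathbf{Rew}^*_I(T)>0$). *)

theory Defs
  imports "HOL-Probability.Probability"
begin

text \<open>
  The data of an instance that a full-information player knows.  Arms and contexts are labelled
  by natural numbers; context \<open>j\<close> occurs with probability \<open>pmf (context_law P) j\<close>.
\<close>

record cbb =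
  arms :: "nat set"
  contexts :: "nat set"
  context_law :: "nat pmf"
  delay :: "nat \<Rightarrow> nat"
  mean_reward :: "nat \<Rightarrow> nat \<Rightarrow> real"

definition cbb :: "cbb \<Rightarrow> bool" where
  "cbb P \<longleftrightarrow> finite (arms P) \<and> arms P \<noteq> {} \<and> finite (contexts P) \<and>
     set_pmf (context_law P) \<subseteq> contexts P \<and> (\<forall>i\<in>arms P. 1 \<le> delay P i) \<and>
     (\<forall>i\<in>arms P. \<forall>j\<in>contexts P. mean_reward P i j \<in> {0..1})"

definition max_delay :: "cbb \<Rightarrow> nat" where
  "max_delay P = Max (delay P ` arms P)"

text \<open>
  \<open>\<nu>\<close> is the joint law of the rewards \<open>(X\<^bsub>i,j,t\<^esub>)\<^bsub>i,j\<^esub>\<close> of a single round.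
  Rewards of different arms and contexts in the same round may be correlated.  The player
  knows only the means.
\<close>

definition reward_law :: "cbb \<Rightarrow> (nat \<times> nat \<Rightarrow> real) measure \<Rightarrow> bool" where
  "reward_law P \<nu> \<longleftrightarrow> prob_space \<nu> \<and>
     sets \<nu> = sets (Pi\<^sub>M (arms P \<times> contexts P) (\<lambda>_. borel)) \<and>
     (\<forall>i\<in>arms P. \<forall>j\<in>contexts P.
        (AE v in \<nu>. v (i, j) \<in> {0..1}) \<and> (\<integral>v. v (i, j) \<partial>\<nu>) = mean_reward P i j)"

text \<open>
  Rounds are numbered from \<open>0\<close>.  Given the actions \<open>as\<close> of all earlier rounds
  (\<open>None\<close> means that no arm is played), arm \<open>i\<close> may be played in round \<open>length as\<close>.
\<close>

definition available :: "cbb \<Rightarrow> nat option list \<Rightarrow> nat \<Rightarrow> bool" where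
  "available P as i \<longleftrightarrow> (\<forall>s<length as. as ! s = Some i \<longrightarrow> s + delay P i \<le> length as)"

definition feasible_action :: "cbb \<Rightarrow> nat option list \<Rightarrow> nat option \<Rightarrow> bool" where
  "feasible_action P as a \<longleftrightarrow> (\<forall>i. a = Some i \<longrightarrow> i \<in> arms P \<and> available P as i)"

text \<open>
  The player's private randomness: an infinite sequence of independent uniform variables, drawn
  independently of contexts and rewards.
\<close>

definition seeds :: "(nat \<Rightarrow> real) measure" where
  "seeds = Pi\<^sub>M UNIV (\<lambda>_. uniform_measure lborel {0..1})"

text \<open>
  \<open>\<pi> P u cs as ys\<close> is the action chosen when the contexts seen so far, including that of the
  current round, are \<open>cs\<close>, and the earlier rounds had actions \<open>as\<close> and collected rewards
  \<open>ys\<close> (\<open>0\<close> in a round without a play).  The horizon need not be an argument of \<open>\<pi>\<close>, because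
  the supremum over \<open>\<pi>\<close> is taken separately for each horizon.
\<close>

type_synonym algorithm =
  "cbb \<Rightarrow> (nat \<Rightarrow> real) \<Rightarrow> nat list \<Rightarrow> nat option list \<Rightarrow> real list \<Rightarrow> nat option"

definition online_algorithm :: "algorithm \<Rightarrow> bool" where
  "online_algorithm \<pi> \<longleftrightarrow> (\<forall>P. cbb P \<longrightarrow>
     (\<forall>u cs as ys. feasible_action P as (\<pi> P u cs as ys)) \<and>
     (\<forall>cs as n. (\<lambda>(u, y). \<pi> P u cs as (map y [0..<n]))
        \<in> measurable (seeds \<Otimes>\<^sub>M Pi\<^sub>M {..<n} (\<lambda>_. borel)) (count_space UNIV)))"

text \<open>
  Actions and collected rewards of the first \<open>t\<close> rounds, for seed \<open>u\<close>, context sequence \<open>c\<close> and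
  rewards \<open>X\<^bsub>i,j,t\<^esub> = x t (i, j)\<close>.
\<close>

primrec run :: "algorithm \<Rightarrow> cbb \<Rightarrow> (nat \<Rightarrow> real) \<Rightarrow> (nat \<Rightarrow> nat) \<Rightarrow> (nat \<Rightarrow> nat \<times> nat \<Rightarrow> real)
    \<Rightarrow> nat \<Rightarrow> nat option list \<times> real list" where
  "run \<pi> P u c x 0 = ([], [])"
| "run \<pi> P u c x (Suc t) =
     (let (as, ys) = run \<pi> P u c x t;
          a = \<pi> P u (map c [0..<Suc t]) as ys
      in (as @ [a], ys @ [case a of None \<Rightarrow> 0 | Some i \<Rightarrow> x t (i, c t)]))"

definition action :: "algorithm \<Rightarrow> cbb \<Rightarrow> (nat \<Rightarrow> real) \<Rightarrow> (nat \<Rightarrow> nat) \<Rightarrow> (nat \<Rightarrow> nat \<times> nat \<Rightarrow> real)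
    \<Rightarrow> nat \<Rightarrow> nat option" where
  "action \<pi> P u c x t = last (fst (run \<pi> P u c x (Suc t)))"

definition context_space :: "cbb \<Rightarrow> nat \<Rightarrow> (nat \<Rightarrow> nat) measure" where
  "context_space P T = Pi\<^sub>M {..<T} (\<lambda>_. measure_pmf (context_law P))"

definition expected_reward ::
    "algorithm \<Rightarrow> cbb \<Rightarrow> (nat \<times> nat \<Rightarrow> real) measure \<Rightarrow> nat \<Rightarrow> real" where
  "expected_reward \<pi> P \<nu> T =
     (\<integral>(u, c, x). (\<Sum>t<T. \<Sum>i\<in>arms P. \<Sum>j\<in>contexts P.
          x t (i, j) * of_bool (action \<pi> P u c x t = Some i \<and> c t = j))
      \<partial>(seeds \<Otimes>\<^sub>M (context_space P T \<Otimes>\<^sub>M Pi\<^sub>M {..<T} (\<lambda>_. \<nu>))))"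

definition schedules :: "cbb \<Rightarrow> nat \<Rightarrow> nat option list set" where
  "schedules P T = {as. length as = T \<and> (\<forall>t<T. feasible_action P (take t as) (as ! t))}"

definition schedule_value :: "cbb \<Rightarrow> nat \<Rightarrow> (nat \<Rightarrow> nat) \<Rightarrow> nat option list \<Rightarrow> real" where
  "schedule_value P T c as =
     (\<Sum>t<T. case as ! t of None \<Rightarrow> 0 | Some i \<Rightarrow> mean_reward P i (c t))"

definition clairvoyant_reward :: "cbb \<Rightarrow> nat \<Rightarrow> real" where
  "clairvoyant_reward P T =
     (\<integral>c. Max (schedule_value P T c ` schedules P T) \<partial>context_space P T)"

definition competitive_ratio :: "nat \<Rightarrow> algorithm \<Rightarrow> nat \<Rightarrow> ereal" where
  "competitive_ratio d \<pi> T =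
     (INF (P, \<nu>) \<in> {(P, \<nu>). cbb P \<and> reward_law P \<nu> \<and> max_delay P = d \<and> 0 < clairvoyant_reward P T}.
        ereal (expected_reward \<pi> P \<nu> T / clairvoyant_reward P T))"

end

theory Submission
  imports Defs
begin

text \<open>
  Fixing the seed and the rewards turns an algorithm into a deterministic player that only sees
  contexts, and the reward of a round is independent of the action chosen in it.  Hence the best
  expected reward is the value \<open>W(P, T)\<close> of a dynamic program, and the supremum over algorithms is
  \<open>s(T) = inf W(P, T) / V(P, T)\<close>, where \<open>V\<close> is the clairvoyant value and \<open>P\<close> ranges over the instances.

  Convergence is a Fekete argument: \<open>W(m + (d - 1) + n) \<ge> W(m) + W(n)\<close> (idle in between) and
  \<open>V(m + n) \<le> V(m) + V(n)\<close> give \<open>s(N) \<ge> \<kappa>(m, N) s(m)\<close>, where \<open>\<kappa>(m, N)\<close> tends to \<open>1\<close> as first \<open>N\<close> and then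
  \<open>m\<close> goes to infinity.

  For the bound take one arm of delay \<open>d\<close>, a context of small probability \<open>p\<close> with reward \<open>1\<close>, and a
  context with reward \<open>(d - 1) p\<close> otherwise.  Online, \<open>W \<le> p (T + d - 1)\<close>, since a play in the common
  context only compensates for the rounds it blocks.  A clairvoyant player collects the common
  reward every \<open>d\<close> rounds without missing the rare context, so that \<open>V\<close> is about
  \<open>p T ((d - 1) / d + 1)\<close>, and the quotient tends to \<open>d / (2 d - 1)\<close>.
\<close>

subsection \<open>Online and clairvoyant values\<close>

definition mean_gain :: "cbb \<Rightarrow> nat option \<Rightarrow> nat \<Rightarrow> real" where
  "mean_gain P a j = (case a of None \<Rightarrow> 0 | Some i \<Rightarrow> mean_reward P i j)"

definition avg :: "cbb \<Rightarrow> (nat \<Rightarrow> real) \<Rightarrow> real" where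
  "avg P f = (\<Sum>j\<in>contexts P. pmf (context_law P) j * f j)"

text \<open>Expectation over \<open>n\<close> independent contexts, written as nested finite sums so
  that the dynamic program stays free of measure theory.\<close>

primrec avgs :: "cbb \<Rightarrow> nat \<Rightarrow> (nat list \<Rightarrow> real) \<Rightarrow> real" where
  "avgs P 0 F = F []"
| "avgs P (Suc n) F = avg P (\<lambda>j. avgs P n (\<lambda>cs. F (j # cs)))"

abbreviation feasible_actions :: "cbb \<Rightarrow> nat option list \<Rightarrow> nat option set" where
  "feasible_actions P as \<equiv> {a. feasible_action P as a}"

text \<open>Bellman recursion over the rounds left. The maximum sits inside the average because the
  current context is seen before acting; the state is the whole action history, since availability
  reads it.\<close>

primrec online_value :: "cbb \<Rightarrow> nat \<Rightarrow> nat option list \<Rightarrow> real" where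
  "online_value P 0 as = 0"
| "online_value P (Suc n) as =
     avg P (\<lambda>j. Max ((\<lambda>a. mean_gain P a j + online_value P n (as @ [a])) ` feasible_actions P as))"

primrec offline_value :: "cbb \<Rightarrow> nat list \<Rightarrow> nat option list \<Rightarrow> real" where
  "offline_value P [] as = 0"
| "offline_value P (j # cs) as =
     Max ((\<lambda>a. mean_gain P a j + offline_value P cs (as @ [a])) ` feasible_actions P as)"

lemma avg_mono: "(\<And>j. j \<in> contexts P \<Longrightarrow> f j \<le> g j) \<Longrightarrow> avg P f \<le> avg P g"
  unfolding avg_def by (intro sum_mono mult_left_mono) auto

lemma avg_cong: "(\<And>j. j \<in> contexts P \<Longrightarrow> f j = g j) \<Longrightarrow> avg P f = avg P g"
  unfolding avg_def by (intro sum.cong) auto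

lemma avg_add: "avg P (\<lambda>j. f j + g j) = avg P f + avg P g"
  unfolding avg_def by (simp add: distrib_left sum.distrib)

lemma avg_const: "cbb P \<Longrightarrow> avg P (\<lambda>_. k) = k"
  unfolding avg_def cbb_def by (simp flip: sum_distrib_right add: sum_pmf_eq_1)

lemma avgs_mono:
  "(\<And>cs. set cs \<subseteq> contexts P \<Longrightarrow> length cs = n \<Longrightarrow> F cs \<le> G cs) \<Longrightarrow> avgs P n F \<le> avgs P n G"
  by (induction n arbitrary: F G) (auto intro!: avg_mono)

lemma avgs_cong:
  assumes "\<And>cs. set cs \<subseteq> contexts P \<Longrightarrow> length cs = n \<Longrightarrow> F cs = G cs"
  shows "avgs P n F = avgs P n G"
  by (intro order.antisym avgs_mono) (use assms in auto)

lemma avgs_add: "avgs P n (\<lambda>cs. F cs + G cs) = avgs P n F + avgs P n G"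
  by (induction n arbitrary: F G) (auto simp: avg_add)

lemma avgs_const: "cbb P \<Longrightarrow> avgs P n (\<lambda>_. k) = k"
  by (induction n) (auto simp: avg_const)

lemma avgs_snoc: "avgs P (Suc n) F = avgs P n (\<lambda>cs. avg P (\<lambda>j. F (cs @ [j])))"
proof (induction n arbitrary: F)
  case (Suc n)
  show ?case by (subst avgs.simps, subst Suc.IH) simp
qed simp

lemma avgs_append: "avgs P (m + n) F = avgs P m (\<lambda>cs. avgs P n (\<lambda>cs'. F (cs @ cs')))"
  by (induction m arbitrary: F) auto

section \<open>Feasibility under cutting and idling\<close>

lemma feasible_None [simp]: "feasible_action P as None"
  by (simp add: feasible_action_def)

lemma finite_feasible_actions [simp]: "cbb P \<Longrightarrow> finite (feasible_actions P as)"
  by (rule finite_subset[of _ "insert None (Some ` arms P)"])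
     (auto simp: feasible_action_def cbb_def not_None_eq)

lemma feasible_actions_nonempty [simp]: "feasible_actions P as \<noteq> {}"
  using feasible_None by blast

lemma Max_feasible_ge: "cbb P \<Longrightarrow> feasible_action P as a \<Longrightarrow> g a \<le> Max (g ` feasible_actions P as)"
  by (intro Max_ge) auto

lemma Max_feasible_le:
  "cbb P \<Longrightarrow> (\<And>a. feasible_action P as a \<Longrightarrow> g a \<le> B) \<Longrightarrow> Max (g ` feasible_actions P as) \<le> (B :: real)"
  by (subst Max_le_iff) (auto intro: exI[of _ None])

lemma Max_feasible_mono:
  assumes "cbb P" "\<And>a. feasible_action P as a \<Longrightarrow> feasible_action P as' a \<and> g a \<le> h a"
  shows "Max (g ` feasible_actions P as) \<le> (Max (h ` feasible_actions P as') :: real)"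
  using assms by (intro Max_feasible_le) (auto intro: order_trans[OF _ Max_feasible_ge])

text \<open>Blocking depends only on differences between rounds, so moving the origin past
  \<open>as\<close> just forgets constraints.\<close>

lemma feasible_action_suffix:
  assumes "feasible_action P (as @ bs) a"
  shows "feasible_action P bs a"
  unfolding feasible_action_def available_def
proof (intro allI impI conjI)
  fix i s assume i: "a = Some i"
  show "i \<in> arms P" using assms i by (simp add: feasible_action_def)
  assume "s < length bs" "bs ! s = Some i"
  then have "(as @ bs) ! (length as + s) = Some i" "length as + s < length (as @ bs)" by auto
  then have "length as + s + delay P i \<le> length (as @ bs)"
    using assms i unfolding feasible_action_def available_def by blast
  then show "s + delay P i \<le> length bs" by simp
qed

lemma delay_le_max_delay: "cbb P \<Longrightarrow> i \<in> arms P \<Longrightarrow> delay P i \<le> max_delay P"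
  unfolding max_delay_def cbb_def by (intro Max_ge) auto

text \<open>The last play in \<open>as\<close> comes at the latest one round before the idle block,
  which is why \<open>max_delay P - 1\<close> idle rounds already free every arm.\<close>

lemma feasible_action_after_idle:
  assumes "cbb P" "max_delay P \<le> Suc k" "feasible_action P bs a"
  shows "feasible_action P (as @ replicate k None @ bs) a"
  unfolding feasible_action_def available_def
proof (intro allI impI conjI)
  fix i s assume i: "a = Some i"
  show ia: "i \<in> arms P" using assms i by (simp add: feasible_action_def)
  assume s: "s < length (as @ replicate k None @ bs)" "(as @ replicate k None @ bs) ! s = Some i"
  consider "s < length as" | "length as \<le> s" "s < length as + k"
    | r where "s = length as + k + r" "r < length bs"
    using s(1) by (metis add.assoc le_add_diff_inverse length_append length_replicate
        nat_add_left_cancel_less not_le)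
  then show "s + delay P i \<le> length (as @ replicate k None @ bs)"
  proof cases
    case 1
    then show ?thesis using delay_le_max_delay[OF assms(1) ia] assms(2) by simp
  next
    case 2
    then have "(as @ replicate k None @ bs) ! s = None" by (auto simp: nth_append)
    then show ?thesis using s by simp
  next
    case 3
    then have "bs ! r = Some i" using s by (simp add: nth_append)
    then have "r + delay P i \<le> length bs"
      using assms(3) i 3 unfolding feasible_action_def available_def by blast
    then show ?thesis using 3 by simp
  qed
qed

text \<open>Quantifying over all continuations \<open>bs\<close> lets the hypothesis pass to the
  extended histories in the induction. The two histories may differ in length, so this serves both
  for cutting and for idling.\<close>

lemma online_value_mono:
  assumes "cbb P" "\<And>bs a. feasible_action P (as @ bs) a \<Longrightarrow> feasible_action P (as' @ bs) a"
  shows "online_value P n as \<le> online_value P n as'"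
  using assms(2)
proof (induction n arbitrary: as as')
  case (Suc n)
  show ?case unfolding online_value.simps
  proof (intro avg_mono Max_feasible_mono assms(1) conjI add_left_mono)
    fix a assume "feasible_action P as a"
    then show "feasible_action P as' a" using Suc.prems[of "[]"] by simp
    show "online_value P n (as @ [a]) \<le> online_value P n (as' @ [a])"
      using Suc.prems[of "a # _"] by (intro Suc.IH) simp
  qed
qed simp

lemma offline_value_mono:
  assumes "cbb P" "\<And>bs a. feasible_action P (as @ bs) a \<Longrightarrow> feasible_action P (as' @ bs) a"
  shows "offline_value P cs as \<le> offline_value P cs as'"
  using assms(2)
proof (induction cs arbitrary: as as')
  case (Cons j cs)
  show ?case unfolding offline_value.simps
  proof (intro Max_feasible_mono assms(1) conjI add_left_mono)
    fix a assume "feasible_action P as a"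
    then show "feasible_action P as' a" using Cons.prems[of "[]"] by simp
    show "offline_value P cs (as @ [a]) \<le> offline_value P cs (as' @ [a])"
      using Cons.prems[of "a # _"] by (intro Cons.IH) simp
  qed
qed simp

lemma online_value_nonneg: "cbb P \<Longrightarrow> 0 \<le> online_value P n as"
proof (induction n arbitrary: as)
  case (Suc n)
  have "avg P (\<lambda>_. 0) \<le> online_value P (Suc n) as" unfolding online_value.simps
  proof (intro avg_mono)
    fix j
    have "0 \<le> mean_gain P None j + online_value P n (as @ [None])"
      using Suc by (simp add: mean_gain_def)
    then show "0 \<le> Max ((\<lambda>a. mean_gain P a j + online_value P n (as @ [a])) ` feasible_actions P as)"
      by (rule order_trans) (rule Max_feasible_ge[OF Suc.prems feasible_None])
  qed
  then show ?case using avg_const[OF Suc.prems] by simp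
qed simp

lemma online_value_skip: "cbb P \<Longrightarrow> online_value P n (as @ [None]) \<le> online_value P (Suc n) as"
proof -
  assume P: "cbb P"
  have "avg P (\<lambda>_. online_value P n (as @ [None])) \<le> online_value P (Suc n) as"
    unfolding online_value.simps
    using Max_feasible_ge[OF P feasible_None, of "\<lambda>a. mean_gain P a _ + online_value P n (as @ [a])" as]
    by (intro avg_mono) (simp add: mean_gain_def)
  then show ?thesis using avg_const[OF P] by simp
qed

lemma online_value_idle:
  "cbb P \<Longrightarrow> online_value P n (as @ replicate k None) \<le> online_value P (k + n) as"
proof (induction k arbitrary: as)
  case (Suc k)
  have "online_value P n ((as @ [None]) @ replicate k None) \<le> online_value P (k + n) (as @ [None])"
    using Suc by blast
  also have "\<dots> \<le> online_value P (Suc k + n) as" using online_value_skip[OF Suc.prems] by simp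
  finally show ?case by simp
qed simp

text \<open>After \<open>m\<close> rounds and \<open>k\<close> idle ones every arm is free and the
  player restarts as from an empty history. The induction on \<open>m\<close> carries the second
  summand through the recursion as a constant.\<close>

lemma online_value_superadditive:
  assumes "cbb P" "max_delay P \<le> Suc k"
  shows "online_value P m as + online_value P n [] \<le> online_value P (m + (k + n)) as"
proof (induction m arbitrary: as)
  case 0
  have "online_value P n [] \<le> online_value P n (as @ replicate k None)"
    using feasible_action_after_idle[OF assms] by (intro online_value_mono assms) simp
  then show ?case using online_value_idle[OF assms(1), of n as k] by simp
next
  case (Suc m)
  have "online_value P (Suc m) as + online_value P n [] =
      avg P (\<lambda>j. Max ((\<lambda>a. mean_gain P a j + online_value P m (as @ [a])) ` feasible_actions P as)
        + online_value P n [])"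
    by (simp add: avg_add avg_const[OF assms(1)])
  also have "\<dots> \<le> online_value P (Suc m + (k + n)) as"
  proof (simp only: add_Suc online_value.simps, intro avg_mono)
    fix j
    have "Max ((\<lambda>a. mean_gain P a j + online_value P m (as @ [a])) ` feasible_actions P as)
      \<le> Max ((\<lambda>a. mean_gain P a j + online_value P (m + (k + n)) (as @ [a])) ` feasible_actions P as)
         - online_value P n []"
    proof (intro Max_feasible_le assms)
      fix a assume a: "feasible_action P as a"
      show "mean_gain P a j + online_value P m (as @ [a])
      \<le> Max ((\<lambda>a. mean_gain P a j + online_value P (m + (k + n)) (as @ [a])) ` feasible_actions P as)
         - online_value P n []"
        using Suc[of "as @ [a]"] Max_feasible_ge[OF assms(1) a,
            of "\<lambda>a. mean_gain P a j + online_value P (m + (k + n)) (as @ [a])"] by linarith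
    qed
    then show "Max ((\<lambda>a. mean_gain P a j + online_value P m (as @ [a])) ` feasible_actions P as)
        + online_value P n []
      \<le> Max ((\<lambda>a. mean_gain P a j + online_value P (m + (k + n)) (as @ [a])) ` feasible_actions P as)"
      by linarith
  qed
  finally show ?case .
qed

lemma online_value_mult:
  assumes "cbb P" "max_delay P \<le> Suc k"
  shows "n * online_value P m [] \<le> online_value P (n * (m + k)) []"
proof (induction n)
  case (Suc n)
  have "real (Suc n) * online_value P m [] = online_value P m [] + n * online_value P m []"
    by (simp add: algebra_simps)
  also have "\<dots> \<le> online_value P m [] + online_value P (n * (m + k)) []" using Suc by simp
  also have "\<dots> \<le> online_value P (Suc n * (m + k)) []"
    using online_value_superadditive[OF assms, of m "[]" "n * (m + k)"] by (simp add: algebra_simps)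
  finally show ?case .
qed simp

lemma online_value_le_add:
  assumes "cbb P"
  shows "online_value P m as \<le> online_value P (m + n) as"
proof (induction m arbitrary: as)
  case 0
  then show ?case using online_value_nonneg[OF assms] by simp
next
  case (Suc m)
  show ?case unfolding online_value.simps add_Suc
    using Suc by (intro avg_mono Max_feasible_mono assms conjI add_left_mono) auto
qed

text \<open>Forgetting the plays made during \<open>cs\<close> only removes blocking, so the rest of
  an optimal schedule competes for \<open>cs'\<close> from an empty history.\<close>

lemma offline_value_append:
  assumes "cbb P"
  shows "offline_value P (cs @ cs') as \<le> offline_value P cs as + offline_value P cs' []"
proof (induction cs arbitrary: as)
  case Nil
  show ?case using feasible_action_suffix by (auto intro!: offline_value_mono assms)
next
  case (Cons j cs)
  show ?case unfolding offline_value.simps append_Cons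
  proof (intro Max_feasible_le assms)
    fix a assume a: "feasible_action P as a"
    show "mean_gain P a j + offline_value P (cs @ cs') (as @ [a])
      \<le> Max ((\<lambda>a. mean_gain P a j + offline_value P cs (as @ [a])) ` feasible_actions P as)
         + offline_value P cs' []"
      using Cons[of "as @ [a]"] Max_feasible_ge[OF assms(1) a,
            of "\<lambda>a. mean_gain P a j + offline_value P cs (as @ [a])"] by linarith
  qed
qed

text \<open>A maximum of averages is at most the average of the maxima.\<close>

lemma online_le_offline:
  assumes "cbb P"
  shows "online_value P n as \<le> avgs P n (\<lambda>cs. offline_value P cs as)"
proof (induction n arbitrary: as)
  case (Suc n)
  show ?case unfolding online_value.simps avgs.simps
  proof (intro avg_mono Max_feasible_le assms)
    fix j a assume a: "feasible_action P as a"
    have "mean_gain P a j + online_value P n (as @ [a])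
        \<le> avgs P n (\<lambda>cs. mean_gain P a j + offline_value P cs (as @ [a]))"
      using Suc by (simp add: avgs_add avgs_const assms)
    also have "\<dots> \<le> avgs P n (\<lambda>cs. offline_value P (j # cs) as)"
      using Max_feasible_ge[OF assms(1) a] by (intro avgs_mono) simp
    finally show "mean_gain P a j + online_value P n (as @ [a])
        \<le> avgs P n (\<lambda>cs. offline_value P (j # cs) as)" .
  qed
qed simp

definition clairvoyant_value :: "cbb \<Rightarrow> nat \<Rightarrow> real" where
  "clairvoyant_value P n = avgs P n (\<lambda>cs. offline_value P cs [])"

lemma clairvoyant_value_0 [simp]: "clairvoyant_value P 0 = 0"
  by (simp add: clairvoyant_value_def)

text \<open>In a single round there is no future context to foresee. This identity links the two
  values in the ratio bound below.\<close>

lemma clairvoyant_value_1: "clairvoyant_value P 1 = online_value P 1 []"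
  by (simp add: clairvoyant_value_def)

lemma clairvoyant_value_add:
  assumes "cbb P"
  shows "clairvoyant_value P (m + n) \<le> clairvoyant_value P m + clairvoyant_value P n"
proof -
  have "clairvoyant_value P (m + n) =
      avgs P m (\<lambda>cs. avgs P n (\<lambda>cs'. offline_value P (cs @ cs') []))"
    by (simp add: clairvoyant_value_def avgs_append)
  also have "\<dots> \<le> avgs P m (\<lambda>cs. avgs P n (\<lambda>cs'. offline_value P cs [] + offline_value P cs' []))"
    by (intro avgs_mono offline_value_append assms)
  also have "\<dots> = clairvoyant_value P m + clairvoyant_value P n"
    by (simp add: clairvoyant_value_def avgs_add avgs_const assms)
  finally show ?thesis .
qed

lemma clairvoyant_value_mult:
  assumes "cbb P"
  shows "clairvoyant_value P (n * m) \<le> n * clairvoyant_value P m"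
proof (induction n)
  case (Suc n)
  then show ?case using clairvoyant_value_add[OF assms, of m "n * m"]
    by (simp add: algebra_simps)
qed simp

lemma online_le_clairvoyant: "cbb P \<Longrightarrow> online_value P n [] \<le> clairvoyant_value P n"
  by (simp add: clairvoyant_value_def online_le_offline)

text \<open>
  Cut \<open>N\<close> rounds into blocks of \<open>m + (d - 1)\<close>.  The online player earns an optimal \<open>m\<close>-round value in each,
  and idles for \<open>d - 1\<close> rounds so that every arm is free again.  The clairvoyant player loses at most
  additively when cut, and the \<open>d - 1\<close> extra rounds are cheap compared with its \<open>m\<close>-round value.
\<close>

lemma value_ratio_bound:
  fixes m N :: nat
  assumes P: "cbb P" "max_delay P = d" "1 \<le> d" and "d \<le> m"
  defines "L \<equiv> m + (d - 1)"
  defines "n \<equiv> N div L"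
  assumes pos: "0 < clairvoyant_value P N"
  shows "0 < clairvoyant_value P m"
    "n / (n + real (n * (d - 1) + L) / real (m div d)) * (online_value P m [] / clairvoyant_value P m)
       \<le> online_value P N [] / clairvoyant_value P N"
proof -
  let ?W = "\<lambda>n. online_value P n []" and ?V = "clairvoyant_value P"
  have d: "max_delay P \<le> Suc (d - 1)" using assms by simp
  define k where "k = m div d"
  have k: "k \<ge> 1" using assms unfolding k_def by (simp add: Suc_le_eq div_greater_zero_iff)
  \<comment> \<open>Positivity at horizon \<open>N\<close> passes to the one-round value
    \<open>?V 1\<close>, the unit in which the error terms are measured.\<close>
  have "?V N \<le> N * ?V 1" using clairvoyant_value_mult[OF P(1), of N 1] by simp
  then have V1: "0 < ?V 1" using pos by (smt (verit) of_nat_0_le_iff mult_nonneg_nonpos)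
  \<comment> \<open>One play in each block of \<open>1 + (d - 1)\<close> rounds.\<close>
  have "k * ?V 1 \<le> ?W (k * d)"
    using online_value_mult[OF P(1) d, of k 1] \<open>1 \<le> d\<close> unfolding clairvoyant_value_1 by simp
  also have "\<dots> \<le> ?W m"
    using online_value_le_add[OF P(1), of "k * d" "[]" "m mod d"] by (simp add: k_def)
  also have "\<dots> \<le> ?V m" by (rule online_le_clairvoyant[OF P(1)])
  finally have kV: "k * ?V 1 \<le> ?V m" .
  then show Vm: "0 < ?V m" using k V1
    by (smt (verit) mult_pos_pos of_nat_0_less_iff of_nat_1 of_nat_le_iff)
  have "n * ?W m \<le> ?W (n * L)" using online_value_mult[OF P(1) d, of n m] by (simp add: L_def)
  also have "\<dots> \<le> ?W N"
    using online_value_le_add[OF P(1), of "n * L" "[]" "N mod L"] by (simp add: n_def)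
  finally have W: "n * ?W m \<le> ?W N" .
  have "N mod L \<le> L" using assms by (simp add: L_def less_imp_le)
  have "?V N \<le> ?V (n * L) + ?V (N mod L)"
    using clairvoyant_value_add[OF P(1), of "n * L" "N mod L"] by (simp add: n_def)
  also have "\<dots> \<le> n * ?V L + (N mod L) * ?V 1"
    using clairvoyant_value_mult[OF P(1), of n L] clairvoyant_value_mult[OF P(1), of "N mod L" 1]
    by simp
  also have "\<dots> \<le> n * (?V m + (d - 1) * ?V 1) + L * ?V 1"
    using clairvoyant_value_mult[OF P(1), of "d - 1" 1] clairvoyant_value_add[OF P(1), of m "d - 1"]
      V1 \<open>N mod L \<le> L\<close>
    by (intro add_mono mult_left_mono mult_right_mono) (auto simp: L_def)
  also have "\<dots> = n * ?V m + real (n * (d - 1) + L) * ?V 1"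
    by (simp only: of_nat_add of_nat_mult distrib_left distrib_right mult.assoc)
  \<comment> \<open>\<open>kV\<close> turns the errors into multiples of \<open>?V m\<close>, so
    that \<open>?V m\<close> factors out and the remaining factor does not depend on the
    instance.\<close>
  also have "\<dots> \<le> n * ?V m + real (n * (d - 1) + L) * (?V m / k)"
    using kV k by (intro add_left_mono mult_left_mono) (auto simp: field_simps)
  also have "\<dots> = ?V m * (n + real (n * (d - 1) + L) / k)"
    by (simp only: distrib_left times_divide_eq_right times_divide_eq_left mult.commute)
  finally have V: "?V N \<le> ?V m * (n + real (n * (d - 1) + L) / k)" .
  have pos2: "0 < n + real (n * (d - 1) + L) / k"
    using V pos Vm by (smt (verit) mult_nonneg_nonpos)
  have "n / (n + real (n * (d - 1) + L) / k) * (?W m / ?V m)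
     = n * ?W m / (?V m * (n + real (n * (d - 1) + L) / k))" by simp
  also have "\<dots> \<le> ?W N / ?V N"
    using V W pos online_value_nonneg[OF P(1)] by (intro frac_le) auto
  finally show "n / (n + real (n * (d - 1) + L) / real (m div d)) * (?W m / ?V m) \<le> ?W N / ?V N"
    by (simp add: k_def)
qed

section \<open>Runs of an algorithm\<close>

lemma run_actions: "fst (run \<pi> P u c x t) = map (action \<pi> P u c x) [0..<t]"
  by (induction t) (auto simp: action_def Let_def split: prod.splits)

lemma run_rewards:
  "snd (run \<pi> P u c x t) =
     map (\<lambda>s. case action \<pi> P u c x s of None \<Rightarrow> 0 | Some i \<Rightarrow> x s (i, c s)) [0..<t]"
  by (induction t) (auto simp: action_def Let_def split: prod.splits)

lemma action_unfold:
  "action \<pi> P u c x t = \<pi> P u (map c [0..<Suc t]) (map (action \<pi> P u c x) [0..<t])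
     (map (\<lambda>s. case action \<pi> P u c x s of None \<Rightarrow> 0 | Some i \<Rightarrow> x s (i, c s)) [0..<t])"
  unfolding run_actions[symmetric] run_rewards[symmetric]
  by (subst action_def) (simp add: Let_def split: prod.splits)

text \<open>Nonanticipation: round \<open>t\<close> reads contexts up to and including
  \<open>t\<close>, but rewards only before \<open>t\<close>. This asymmetry later makes the reward
  of a round independent of its action.\<close>

lemma action_cong:
  assumes "\<And>s. s \<le> t \<Longrightarrow> c s = c' s" "\<And>s. s < t \<Longrightarrow> x s = x' s"
  shows "action \<pi> P u c x t = action \<pi> P u c' x' t"
  using assms
proof (induction t rule: less_induct)
  case (less t)
  have eq: "map (action \<pi> P u c x) [0..<t] = map (action \<pi> P u c' x') [0..<t]"
    using less by auto
  have eq2: "map (\<lambda>s. case action \<pi> P u c x s of None \<Rightarrow> 0 | Some i \<Rightarrow> x s (i, c s)) [0..<t]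
     = map (\<lambda>s. case action \<pi> P u c' x' s of None \<Rightarrow> 0 | Some i \<Rightarrow> x' s (i, c' s)) [0..<t]"
    using less by (intro map_cong refl) (auto split: option.splits)
  have eq3: "map c [0..<Suc t] = map c' [0..<Suc t]" using less.prems by auto
  show ?case by (simp only: action_unfold[of _ _ _ _ _ t] eq eq2 eq3)
qed

lemma action_feasible:
  "online_algorithm \<pi> \<Longrightarrow> cbb P \<Longrightarrow>
    feasible_action P (map (action \<pi> P u c x) [0..<t]) (action \<pi> P u c x t)"
  unfolding action_unfold[of \<pi> P u c x t] by (simp add: online_algorithm_def)

text \<open>
  A deterministic player is a function \<open>\<sigma>\<close> of the contexts seen so far, current one included; the earlier
  actions, on which feasibility depends, are recovered by applying \<open>\<sigma>\<close> to the prefixes.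
\<close>

lemma policy_gain_Suc:
  "(\<Sum>k<Suc n. mean_gain P (\<sigma> (ds @ take (Suc k) (j # cs))) ((j # cs) ! k)) =
    mean_gain P (\<sigma> (ds @ [j])) j + (\<Sum>k<n. mean_gain P (\<sigma> ((ds @ [j]) @ take (Suc k) cs)) (cs ! k))"
  by (subst sum.lessThan_Suc_shift) simp

text \<open>Induction on the rounds left, for all seen prefixes \<open>ds\<close>: the action of the
  player is one candidate in the Bellman maximum.\<close>

lemma policy_gain_le_online_value:
  assumes "cbb P"
    and "\<And>cs. cs \<noteq> [] \<Longrightarrow> feasible_action P (map (\<lambda>k. \<sigma> (take (Suc k) cs)) [0..<length cs - 1]) (\<sigma> cs)"
  shows "avgs P n (\<lambda>cs. \<Sum>k<n. mean_gain P (\<sigma> (ds @ take (Suc k) cs)) (cs ! k))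
     \<le> online_value P n (map (\<lambda>k. \<sigma> (take (Suc k) ds)) [0..<length ds])"
proof (induction n arbitrary: ds)
  case (Suc n)
  show ?case unfolding online_value.simps avgs.simps policy_gain_Suc avgs_add avgs_const[OF assms(1)]
  proof (rule avg_mono)
    fix j
    let ?as = "map (\<lambda>k. \<sigma> (take (Suc k) ds)) [0..<length ds]"
    have as: "map (\<lambda>k. \<sigma> (take (Suc k) (ds @ [j]))) [0..<length (ds @ [j])] = ?as @ [\<sigma> (ds @ [j])]"
      by simp
    have "map (\<lambda>k. \<sigma> (take (Suc k) (ds @ [j]))) [0..<length (ds @ [j]) - 1] = ?as"
      by simp
    then have "feasible_action P ?as (\<sigma> (ds @ [j]))"
      using assms(2)[of "ds @ [j]"] by (metis snoc_eq_iff_butlast)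
    from Max_feasible_ge[OF assms(1) this, of "\<lambda>a. mean_gain P a j + online_value P n (?as @ [a])"]
    show "mean_gain P (\<sigma> (ds @ [j])) j +
      avgs P n (\<lambda>cs. \<Sum>k<n. mean_gain P (\<sigma> ((ds @ [j]) @ take (Suc k) cs)) (cs ! k))
      \<le> Max ((\<lambda>a. mean_gain P a j + online_value P n (?as @ [a])) ` feasible_actions P ?as)"
      using Suc[of "ds @ [j]", unfolded as] by linarith
  qed
qed simp

text \<open>The horizon enters through the number of rounds left after the current one; the current
  round is the length of the history.\<close>

definition greedy :: "cbb \<Rightarrow> nat \<Rightarrow> nat option list \<Rightarrow> nat \<Rightarrow> nat option" where
  "greedy P T as j = (ARG_MAX (\<lambda>a. mean_gain P a j + online_value P (T - Suc (length as)) (as @ [a]))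
     a. feasible_action P as a)"

text \<open>\<open>ARG_MAX\<close> is a Hilbert choice, so a maximiser has to exist; finiteness of
  the feasible actions provides it.\<close>

lemma greedy_is_arg_max:
  assumes "cbb P"
  shows "is_arg_max (\<lambda>a. mean_gain P a j + online_value P (T - Suc (length as)) (as @ [a]))
     (feasible_action P as) (greedy P T as j)"
proof -
  let ?g = "\<lambda>a. mean_gain P a j + online_value P (T - Suc (length as)) (as @ [a])"
  have "Max (?g ` feasible_actions P as) \<in> ?g ` feasible_actions P as"
    using finite_feasible_actions[OF assms] feasible_actions_nonempty by (intro Max_in) blast+
  then obtain a where "feasible_action P as a" "?g a = Max (?g ` feasible_actions P as)" by auto
  then have "is_arg_max ?g (feasible_action P as) a"
    using Max_feasible_ge[OF assms, of as _ ?g] by (auto simp: is_arg_max_linorder)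
  then show ?thesis unfolding greedy_def arg_max_def by (rule someI[of "is_arg_max ?g _"])
qed

lemma greedy_feasible: "cbb P \<Longrightarrow> feasible_action P as (greedy P T as j)"
  using greedy_is_arg_max by (auto simp: is_arg_max_linorder)

lemma greedy_Max:
  assumes "cbb P" "T = length as + Suc n"
  shows "mean_gain P (greedy P T as j) j + online_value P n (as @ [greedy P T as j])
    = Max ((\<lambda>a. mean_gain P a j + online_value P n (as @ [a])) ` feasible_actions P as)"
  using greedy_is_arg_max[OF assms(1), of j T as] assms finite_feasible_actions[OF assms(1)]
  by (intro Max_eqI[symmetric]) (auto simp: is_arg_max_linorder)

text \<open>The induction of the upper bound with equality, since the greedy action attains each
  Bellman maximum. \<open>T = length ds + n\<close> aligns the round count inside
  \<open>greedy\<close> with the recursion.\<close>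

lemma greedy_policy_gain:
  assumes "cbb P"
    and "\<And>cs. cs \<noteq> [] \<Longrightarrow> \<sigma> cs = greedy P T (map (\<lambda>k. \<sigma> (take (Suc k) cs)) [0..<length cs - 1]) (last cs)"
    and "T = length ds + n"
  shows "avgs P n (\<lambda>cs. \<Sum>k<n. mean_gain P (\<sigma> (ds @ take (Suc k) cs)) (cs ! k))
     = online_value P n (map (\<lambda>k. \<sigma> (take (Suc k) ds)) [0..<length ds])"
  using assms(3)
proof (induction n arbitrary: ds)
  case (Suc n)
  show ?case unfolding online_value.simps avgs.simps policy_gain_Suc avgs_add avgs_const[OF assms(1)]
  proof (rule avg_cong)
    fix j
    let ?as = "map (\<lambda>k. \<sigma> (take (Suc k) ds)) [0..<length ds]"
    have as: "map (\<lambda>k. \<sigma> (take (Suc k) (ds @ [j]))) [0..<length (ds @ [j])] = ?as @ [\<sigma> (ds @ [j])]"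
      by simp
    have "map (\<lambda>k. \<sigma> (take (Suc k) (ds @ [j]))) [0..<length (ds @ [j]) - 1] = ?as"
      by simp
    then have g: "\<sigma> (ds @ [j]) = greedy P T ?as j"
      using assms(2)[of "ds @ [j]"] by (metis snoc_eq_iff_butlast last_snoc)
    have IH: "avgs P n (\<lambda>cs. \<Sum>k<n. mean_gain P (\<sigma> ((ds @ [j]) @ take (Suc k) cs)) (cs ! k))
      = online_value P n (?as @ [\<sigma> (ds @ [j])])"
      using Suc.IH[of "ds @ [j]", unfolded as] Suc.prems by simp
    show "mean_gain P (\<sigma> (ds @ [j])) j +
      avgs P n (\<lambda>cs. \<Sum>k<n. mean_gain P (\<sigma> ((ds @ [j]) @ take (Suc k) cs)) (cs ! k))
      = Max ((\<lambda>a. mean_gain P a j + online_value P n (?as @ [a])) ` feasible_actions P ?as)"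
      unfolding IH unfolding g by (rule greedy_Max[OF assms(1)]) (use Suc.prems in simp)
  qed
qed simp

section \<open>The clairvoyant recursion and optimal schedules\<close>

lemma offline_value_ge_schedule:
  assumes "cbb P" "\<And>t. t < length cs \<Longrightarrow> feasible_action P (as @ take t bs) (bs ! t)"
    "length bs = length cs"
  shows "(\<Sum>t<length cs. mean_gain P (bs ! t) (cs ! t)) \<le> offline_value P cs as"
  using assms(2,3)
proof (induction cs arbitrary: as bs)
  case (Cons j cs)
  from Cons.prems(2) obtain b bs' where bs: "bs = b # bs'" by (cases bs) auto
  have "(\<Sum>t<length cs. mean_gain P (bs' ! t) (cs ! t)) \<le> offline_value P cs (as @ [b])"
    using Cons.prems(1)[of "Suc _"] Cons.prems(2) by (intro Cons.IH) (auto simp: bs)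
  moreover have "feasible_action P as b" using Cons.prems(1)[of 0] by (simp add: bs)
  then have "mean_gain P b j + offline_value P cs (as @ [b]) \<le> offline_value P (j # cs) as"
    using Max_feasible_ge[OF assms(1), of as b "\<lambda>a. mean_gain P a j + offline_value P cs (as @ [a])"]
    by simp
  moreover have "(\<Sum>t<length (j # cs). mean_gain P (bs ! t) ((j # cs) ! t)) =
      mean_gain P b j + (\<Sum>t<length cs. mean_gain P (bs' ! t) (cs ! t))"
    unfolding bs list.size(4) add_0_right add_Suc_right by (subst sum.lessThan_Suc_shift) simp
  ultimately show ?case by linarith
qed simp

lemma offline_value_attained:
  assumes "cbb P"
  shows "\<exists>bs. length bs = length cs \<and> (\<forall>t<length cs. feasible_action P (as @ take t bs) (bs ! t)) \<and>
     offline_value P cs as = (\<Sum>t<length cs. mean_gain P (bs ! t) (cs ! t))"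
proof (induction cs arbitrary: as)
  case (Cons j cs)
  let ?g = "\<lambda>a. mean_gain P a j + offline_value P cs (as @ [a])"
  have "Max (?g ` feasible_actions P as) \<in> ?g ` feasible_actions P as"
    using finite_feasible_actions[OF assms] feasible_actions_nonempty by (intro Max_in) blast+
  then obtain a where a: "feasible_action P as a" "offline_value P (j # cs) as = ?g a" by auto
  from Cons[of "as @ [a]"] obtain bs where bs: "length bs = length cs"
    "\<forall>t<length cs. feasible_action P ((as @ [a]) @ take t bs) (bs ! t)"
    "offline_value P cs (as @ [a]) = (\<Sum>t<length cs. mean_gain P (bs ! t) (cs ! t))" by blast
  show ?case
  proof (intro exI[of _ "a # bs"] conjI allI impI)
    fix t assume "t < length (j # cs)"
    then show "feasible_action P (as @ take t (a # bs)) ((a # bs) ! t)"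
      using a bs by (cases t) auto
  qed (use a bs in \<open>auto simp: sum.lessThan_Suc_shift simp del: sum.lessThan_Suc\<close>)
qed simp

text \<open>The recursion chooses one action at a time, \<open>schedules\<close> whole lists at
  once: its value dominates every schedule and is attained by one.\<close>

lemma Max_schedule_value:
  assumes "cbb P"
  shows "Max (schedule_value P T c ` schedules P T) = offline_value P (map c [0..<T]) []"
proof (rule Max_eqI)
  have "schedules P T \<subseteq> {as. set as \<subseteq> insert None (Some ` arms P) \<and> length as = T}"
  proof safe
    fix as a assume as: "as \<in> schedules P T" "a \<in> set as" "a \<notin> Some ` arms P"
    then obtain t where "t < T" "a = as ! t" by (auto simp: schedules_def in_set_conv_nth)
    then have "feasible_action P (take t as) a" using as by (simp add: schedules_def)
    then show "a = None" using as(3) by (cases a) (auto simp: feasible_action_def)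
  qed (simp add: schedules_def)
  then have "finite (schedules P T)"
    by (rule finite_subset) (use assms in \<open>simp add: cbb_def finite_lists_length_eq\<close>)
  then show "finite (schedule_value P T c ` schedules P T)" by simp
  have eq: "schedule_value P T c as = (\<Sum>t<length (map c [0..<T]). mean_gain P (as ! t) (map c [0..<T] ! t))" for as
    by (simp add: schedule_value_def mean_gain_def cong: option.case_cong)
  show "y \<le> offline_value P (map c [0..<T]) []" if "y \<in> schedule_value P T c ` schedules P T" for y
  proof -
    obtain as where "as \<in> schedules P T" and y: "y = schedule_value P T c as"
      using \<open>y \<in> schedule_value P T c ` schedules P T\<close> by blast
    then show ?thesis unfolding y eq
      by (intro offline_value_ge_schedule assms) (auto simp: schedules_def)
  qed
  show "offline_value P (map c [0..<T]) [] \<in> schedule_value P T c ` schedules P T"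
    using offline_value_attained[OF assms, of "map c [0..<T]" "[]"] unfolding eq
    by (auto simp: schedules_def)
qed

subsection \<open>The hard instance\<close>

text \<open>
  A single arm and two contexts: context \<open>1\<close> is rare (probability \<open>p\<close>) and pays \<open>1\<close>, context \<open>0\<close> pays
  \<open>(d - 1) p\<close>.  This is the common reward that makes an online player, when the arm is free in
  context \<open>0\<close>, indifferent between playing and waiting: playing blocks the next \<open>d - 1\<close> rounds, each
  worth about \<open>p\<close>.
\<close>

definition hard_instance :: "nat \<Rightarrow> real \<Rightarrow> cbb" where
  "hard_instance d p = \<lparr>arms = {0}, contexts = {0, 1},
     context_law = map_pmf of_bool (bernoulli_pmf p), delay = (\<lambda>_. d),
     mean_reward = (\<lambda>i j. if j = 1 then 1 else real (d - 1) * p)\<rparr>"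

lemma hard_instance_simps [simp]:
  "arms (hard_instance d p) = {0}" "contexts (hard_instance d p) = {0, 1}"
  "delay (hard_instance d p) = (\<lambda>_. d)"
  "mean_reward (hard_instance d p) i j = (if j = 1 then 1 else real (d - 1) * p)"
  "max_delay (hard_instance d p) = d"
  by (simp_all add: hard_instance_def max_delay_def)

lemma hard_instance_avg:
  assumes "0 \<le> p" "p \<le> 1"
  shows "avg (hard_instance d p) f = (1 - p) * f 0 + p * f 1"
proof -
  have inj: "inj (of_bool :: bool \<Rightarrow> nat)" by (auto simp: inj_def)
  have "pmf (map_pmf (of_bool :: bool \<Rightarrow> nat) (bernoulli_pmf p)) 0 = 1 - p"
    using pmf_map_inj'[OF inj, of "bernoulli_pmf p" False] assms by simp
  moreover have "pmf (map_pmf (of_bool :: bool \<Rightarrow> nat) (bernoulli_pmf p)) 1 = p"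
    using pmf_map_inj'[OF inj, of "bernoulli_pmf p" True] assms by simp
  ultimately show ?thesis by (simp add: avg_def hard_instance_def)
qed

context
  fixes d :: nat and p :: real
  assumes d: "1 \<le> d" and p: "0 \<le> p" "p \<le> 1" "real (d - 1) * p \<le> 1"
begin

private abbreviation "H \<equiv> hard_instance d p"

lemma cbb_hard_instance: "cbb H"
  using d p by (auto simp: cbb_def hard_instance_def)

text \<open>\<open>k\<close> counts rounds in which the arm is surely still blocked. Each other
  round is worth \<open>p\<close>, and the surplus \<open>(d - 1) p\<close> pays for late plays
  whose blocked rounds run past the horizon.\<close>

lemma online_value_hard_instance:
  assumes "\<And>bs. length bs < k \<Longrightarrow> \<not> available H (as @ bs) 0" "k \<le> d - 1"
  shows "online_value H n as \<le> p * (real n - real k) + real (d - 1) * p"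
  using assms
proof (induction n arbitrary: as k)
  case 0
  have "p * (real (d - 1) - real k) \<ge> 0" using p 0 by simp
  then show ?case by (simp add: algebra_simps)
next
  case (Suc n)
  show ?case
  proof (cases k)
    case (Suc l)
    have "\<not> available H as 0" using Suc.prems(1)[of "[]"] Suc by simp
    then have "a = None" if "feasible_action H as a" for a
      using that by (cases a) (auto simp: feasible_action_def)
    then have "feasible_actions H as = {None}" by auto
    then have "online_value H (Suc n) as = online_value H n (as @ [None])"
      by (simp add: mean_gain_def avg_const cbb_hard_instance)
    also have "\<dots> \<le> p * (real n - real l) + real (d - 1) * p"
      using Suc.prems Suc by (intro Suc.IH) auto
    finally show ?thesis using Suc by simp
  next
    case 0
    have wait: "online_value H n (as @ [None]) \<le> p * real n + real (d - 1) * p"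
      using Suc.IH[of 0 "as @ [None]"] by simp
    have play: "online_value H n (as @ [Some 0]) \<le> p * (real n - real (d - 1)) + real (d - 1) * p"
    proof (rule Suc.IH)
      fix bs :: "nat option list" assume "length bs < d - 1"
      then show "\<not> available H ((as @ [Some 0]) @ bs) 0"
        unfolding available_def by (auto intro!: exI[of _ "length as"])
    qed simp
    \<comment> \<open>In context \<open>0\<close> playing and waiting lead to the same bound, as the
      reward cancels the cost of the blocked rounds. In context \<open>1\<close> playing has the
      larger bound because \<open>(d - 1) p \<le> 1\<close>.\<close>
    have "online_value H (Suc n) as \<le> avg H (\<lambda>j. if j = 1 then 1 + p * real n else p * real n + real (d - 1) * p)"
      unfolding online_value.simps
    proof (intro avg_mono Max_feasible_le cbb_hard_instance)
      fix j a assume "feasible_action H as a"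
      then have "a = None \<or> a = Some 0" by (cases a) (auto simp: feasible_action_def)
      then show "mean_gain H a j + online_value H n (as @ [a]) \<le>
        (if j = 1 then 1 + p * real n else p * real n + real (d - 1) * p)"
        using wait play p by (auto simp: mean_gain_def algebra_simps)
    qed
    also have "\<dots> = p * real (Suc n) + real (d - 1) * p - p * (real (d - 1) * p)"
      by (subst hard_instance_avg) (use p in \<open>simp_all add: algebra_simps\<close>)
    also have "\<dots> \<le> p * real (Suc n) + real (d - 1) * p" using p by simp
    finally show ?thesis using 0 by simp
  qed
qed

text \<open>The complementary event, \<open>n\<close> independent common contexts, has probability
  \<open>(1 - p) ^ n\<close>.\<close>

lemma avgs_hard_instance_no_1: "avgs H n (\<lambda>cs. of_bool (1 \<in> set cs)) = 1 - (1 - p) ^ n"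
proof (induction n)
  case (Suc n)
  then show ?case using p
    by (simp add: hard_instance_avg Suc.IH avgs_const[OF cbb_hard_instance] del: One_nat_def)
       (simp add: algebra_simps)
qed simp

text \<open>
  The clairvoyant player plays in the residue class modulo \<open>d\<close> that contains a rare round.
\<close>

lemma offline_value_hard_instance:
  assumes "length cs = T" "set cs \<subseteq> {0, 1}" "d \<le> T"
  shows "real (d - 1) * p * (real (T div d) - 1) + of_bool (1 \<in> set cs) \<le> offline_value H cs []"
proof -
  \<comment> \<open>A rare round if there is one, and otherwise an arbitrary round.\<close>
  obtain t0 where t0: "t0 < T" "1 \<in> set cs \<Longrightarrow> cs ! t0 = 1"
    using assms d by (metis in_set_conv_nth less_le_trans less_one linorder_not_less not_gr0)
  define S where "S = {t. t < T \<and> t mod d = t0 mod d}"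
  define bs where "bs = map (\<lambda>t. if t \<in> S then Some 0 else (None :: nat option)) [0..<T]"
  have feas: "feasible_action H ([] @ take t bs) (bs ! t)" if "t < length cs" for t
  proof -
    have "s + d \<le> t" if "s < t" "s mod d = t0 mod d" "t mod d = t0 mod d" for s
    proof -
      have "d dvd t - s" using that by (metis mod_eq_dvd_iff_nat less_imp_le)
      then show ?thesis using that dvd_imp_le[of d "t - s"] by linarith
    qed
    then show ?thesis using that assms(1)
      by (auto simp: feasible_action_def available_def bs_def S_def split: if_splits)
  qed
  have le1: "mean_gain H (Some 0) j \<ge> real (d - 1) * p" for j
    using p by (simp add: mean_gain_def)
  have fin: "finite S" "t0 \<in> S" using t0 by (auto simp: S_def)
  \<comment> \<open>Every full block of \<open>d\<close> rounds contains one round of the residue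
    class.\<close>
  have "inj_on (\<lambda>q. q * d + t0 mod d) {..<T div d}" using d by (auto simp: inj_on_def)
  moreover have "(\<lambda>q. q * d + t0 mod d) ` {..<T div d} \<subseteq> S"
  proof safe
    fix q assume "q < T div d"
    then have "(q + 1) * d \<le> T" by (metis Suc_eq_plus1 Suc_leI div_times_less_eq_dividend le_trans mult_le_mono1)
    moreover have "t0 mod d < d" using d by simp
    ultimately show "q * d + t0 mod d \<in> S" by (simp add: S_def)
  qed
  ultimately have card: "T div d \<le> card S" using fin by (metis card_inj_on_le card_lessThan)
  \<comment> \<open>The play in round \<open>t0\<close> is counted separately, hence the
    \<open>- 1\<close>; all other plays earn at least the common reward.\<close>
  have "real (d - 1) * p * (real (T div d) - 1) + of_bool (1 \<in> set cs)
    \<le> real (d - 1) * p * (real (card S) - 1) + mean_gain H (Some 0) (cs ! t0)"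
    using card p t0(2) by (intro add_mono mult_left_mono) (auto simp: mean_gain_def)
  also have "\<dots> = (\<Sum>t\<in>S - {t0}. real (d - 1) * p) + mean_gain H (Some 0) (cs ! t0)"
    using fin card_gt_0_iff[of S] by (auto simp: card_Diff_singleton of_nat_diff)
  also have "\<dots> \<le> (\<Sum>t\<in>S - {t0}. mean_gain H (Some 0) (cs ! t)) + mean_gain H (Some 0) (cs ! t0)"
    by (intro add_mono sum_mono le1) simp
  also have "\<dots> = (\<Sum>t\<in>S. mean_gain H (Some 0) (cs ! t))"
    using fin by (simp add: sum.remove)
  also have "\<dots> = (\<Sum>t<length cs. mean_gain H (bs ! t) (cs ! t))"
    by (rule sum.mono_neutral_cong_left) (auto simp: S_def bs_def assms mean_gain_def)
  also have "\<dots> \<le> offline_value H cs []"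
    by (rule offline_value_ge_schedule) (use feas assms in \<open>simp_all add: bs_def cbb_hard_instance\<close>)
  finally show ?thesis .
qed

lemma clairvoyant_value_hard_instance:
  assumes "d \<le> T"
  shows "real (d - 1) * p * (real (T div d) - 1) + (1 - (1 - p) ^ T) \<le> clairvoyant_value H T"
proof -
  have "avgs H T (\<lambda>cs. real (d - 1) * p * (real (T div d) - 1) + of_bool (1 \<in> set cs))
     \<le> clairvoyant_value H T"
    unfolding clairvoyant_value_def by (intro avgs_mono offline_value_hard_instance assms) auto
  then show ?thesis by (simp add: avgs_add avgs_const cbb_hard_instance avgs_hard_instance_no_1 del: One_nat_def)
qed

end

text \<open>
  The rare probability \<open>p = 1 / T\<^sup>2\<close> depends on the horizon, so that asymptotically at most one rare
  context occurs.  The quotient below is the resulting ratio, both values being scaled by \<open>T\<close>.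
\<close>

definition ratio_bound :: "nat \<Rightarrow> nat \<Rightarrow> real" where
  "ratio_bound d T = (1 + (real d - 1) / T) /
     ((real d - 1) * (1 / real d - 2 / T) + 1 / (1 + 1 / T))"

lemma hard_instance_ratio:
  fixes d T :: nat
  assumes "1 \<le> d" "2 * d \<le> T"
  defines "P \<equiv> hard_instance d (1 / T\<^sup>2)"
  shows "cbb P" "0 < clairvoyant_value P T"
    "online_value P T [] / clairvoyant_value P T \<le> ratio_bound d T"
proof -
  define p :: real where "p = 1 / T\<^sup>2"
  have T: "0 < real T" using assms by simp
  have "real (d - 1) \<le> real T" "1 \<le> real T" using assms by (auto simp: of_nat_diff)
  then have "real (d - 1) * 1 \<le> real T * real T" "1 * 1 \<le> real T * real T"
    by (intro mult_mono; simp)+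
  then have p: "0 \<le> p" "p \<le> 1" "real (d - 1) * p \<le> 1"
    using T by (auto simp: p_def power2_eq_square divide_simps)
  have P: "P = hard_instance d p" by (simp add: P_def p_def)
  show "cbb P" unfolding P by (rule cbb_hard_instance[OF assms(1) p])
  let ?B = "(real d - 1) * (1 / real d - 2 / T) + 1 / (1 + 1 / T)"
  have W: "online_value P T [] \<le> (1 + (real d - 1) / T) / T"
    using online_value_hard_instance[OF assms(1) p, of 0 "[]" T] T assms
    by (simp add: P p_def power2_eq_square field_simps of_nat_diff)
  \<comment> \<open>Lower bound on the probability of a rare round: Bernoulli's inequality yields
    \<open>(1 - p) ^ T \<le> 1 / (1 + T * p)\<close>, and here \<open>T * p = 1 / T\<close>.\<close>
  have "(1 + T * p) * (1 - p) ^ T \<le> (1 + p) ^ T * (1 - p) ^ T"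
    using p by (intro mult_right_mono Bernoulli_inequality) auto
  also have "\<dots> = (1 - p * p) ^ T" by (simp add: power_mult_distrib[symmetric] algebra_simps)
  also have "\<dots> \<le> 1" using p by (intro power_le_one) (auto simp: mult_le_one)
  finally have "(1 - p) ^ T \<le> 1 / (1 + T * p)" using p by (simp add: field_simps add_pos_nonneg)
  also have "\<dots> = 1 - 1 / (1 + 1 / T) / T"
    using T mult_pos_pos[OF T T] by (simp add: add_nonneg_eq_0_iff p_def power2_eq_square field_simps)
  finally have A: "1 / (1 + 1 / T) / T \<le> 1 - (1 - p) ^ T" by simp
  have "real T / d - 1 \<le> real (T div d)"
    using floor_divide_of_nat_eq[of T d, where ?'a = real] by linarith
  then have "(real d - 1) * p * (real T / d - 2) \<le> real (d - 1) * p * (real (T div d) - 1)"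
    using p assms(1) by (simp add: of_nat_diff mult_left_mono)
  moreover have "(real d - 1) * p * (real T / d - 2) = (real d - 1) * (1 / real d - 2 / T) / T"
    using T assms(1) by (simp add: p_def power2_eq_square field_simps)
  ultimately have V: "?B / T \<le> clairvoyant_value P T"
    using A clairvoyant_value_hard_instance[OF assms(1) p, of T] assms(2) unfolding P
    by (simp add: add_divide_distrib)
  \<comment> \<open>\<open>2 * d \<le> T\<close> keeps the first summand of \<open>?B\<close>
    nonnegative; the second one is positive.\<close>
  have "2 / T \<le> 1 / d" using T assms by (simp add: field_simps)
  then have B: "0 < ?B" using assms(1) T by (intro add_nonneg_pos mult_nonneg_nonneg) (auto intro: add_pos_pos)
  then show "0 < clairvoyant_value P T" using V T by (smt (verit) divide_pos_pos)
  have "online_value P T [] / clairvoyant_value P T \<le> ((1 + (real d - 1) / T) / T) / (?B / T)"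
    using W V B T assms(1) by (intro frac_le) auto
  also have "\<dots> = ratio_bound d T" using T by (simp add: ratio_bound_def)
  finally show "online_value P T [] / clairvoyant_value P T \<le> ratio_bound d T" .
qed

lemma ratio_bound_tendsto:
  assumes "1 \<le> d"
  shows "ratio_bound d \<longlonglongrightarrow> real d / (2 * real d - 1)"
proof -
  have "ratio_bound d \<longlonglongrightarrow> (1 + 0) / ((real d - 1) * (1 / real d - 0) + 1 / (1 + 0))"
    unfolding ratio_bound_def
    by (intro tendsto_intros lim_const_over_n) (use assms in \<open>auto simp: field_simps\<close>)
  also have "(1 + 0) / ((real d - 1) * (1 / real d - 0) + 1 / (1 + 0)) = real d / (2 * real d - 1)"
    using assms by (simp add: field_simps)
  finally show ?thesis .
qed

subsection \<open>Expected rewards of algorithms\<close>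

lemma prob_space_context_space: "prob_space (context_space P T)"
  unfolding context_space_def by (intro prob_space_PiM measure_pmf.prob_space_axioms)

lemma prob_space_seeds: "prob_space seeds"
  unfolding seeds_def by (intro prob_space_PiM prob_space_uniform_measure) simp_all

lemma AE_context_space:
  assumes "cbb P"
  shows "AE c in context_space P T. \<forall>t<T. c t \<in> contexts P"
proof -
  have "AE j in measure_pmf (context_law P). j \<in> contexts P"
    using assms by (auto simp: AE_measure_pmf_iff cbb_def)
  then have "AE c in context_space P T. c t \<in> contexts P" if "t \<in> {..<T}" for t
    using that unfolding context_space_def
    by (intro AE_PiM_component) (auto intro: measure_pmf.prob_space_axioms)
  then have "AE c in context_space P T. \<forall>t\<in>{..<T}. c t \<in> contexts P"
    by (intro AE_finite_allI) auto
  then show ?thesis by (simp add: Ball_def)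
qed

lemma measurable_map_upt:
  fixes f :: "nat \<Rightarrow> 'a \<Rightarrow> 'b :: countable"
  assumes "\<And>s. s < t \<Longrightarrow> f s \<in> measurable M (count_space UNIV)"
  shows "(\<lambda>\<omega>. map (\<lambda>s. f s \<omega>) [0..<t]) \<in> measurable M (count_space UNIV)"
  using assms
proof (induction t)
  case (Suc t)
  have "(\<lambda>\<omega>. map (\<lambda>s. f s \<omega>) [0..<t] @ [f t \<omega>]) \<in> measurable M (count_space UNIV)"
    by (rule measurable_compose_countable[where g = "f t"],
        rule measurable_compose_countable[where g = "\<lambda>\<omega>. map (\<lambda>s. f s \<omega>) [0..<t]"])
       (use Suc in auto)
  then show ?case by simp
qed simp

lemma measurable_context_component:
  "t < T \<Longrightarrow> (\<lambda>c. c t) \<in> measurable (context_space P T) (count_space UNIV)"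
proof -
  assume "t < T"
  then have "(\<lambda>c. c t) \<in> measurable (context_space P T) (measure_pmf (context_law P))"
    unfolding context_space_def by (intro measurable_component_singleton) simp
  then show ?thesis by simp
qed

lemma integral_context_law:
  "cbb P \<Longrightarrow> (\<integral>j. f j \<partial>measure_pmf (context_law P)) = avg P f"
  by (subst integral_measure_pmf_real[of "contexts P"])
     (auto simp: cbb_def avg_def mult.commute)

text \<open>Context lists are discrete, so every \<open>F\<close> is measurable; almost surely only
  finitely many lists occur, so it is bounded.\<close>

lemma integrable_context_space:
  fixes F :: "nat list \<Rightarrow> real"
  assumes "cbb P"
  shows "integrable (context_space P T) (\<lambda>c. F (map c [0..<T]))"
proof -
  interpret prob_space "context_space P T" by (rule prob_space_context_space)
  define S where "S = {cs. set cs \<subseteq> contexts P \<and> length cs = T}"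
  have fin: "finite S" using assms by (auto simp: S_def cbb_def finite_lists_length_eq)
  show ?thesis
  proof (rule integrable_const_bound[where B = "\<Sum>cs\<in>S. \<bar>F cs\<bar>"])
    show "AE c in context_space P T. norm (F (map c [0..<T])) \<le> (\<Sum>cs\<in>S. \<bar>F cs\<bar>)"
      using AE_context_space[OF assms, of T]
    proof eventually_elim
      case (elim c)
      then have "map c [0..<T] \<in> S" by (auto simp: S_def)
      then show ?case using member_le_sum[of "map c [0..<T]" S "\<lambda>cs. \<bar>F cs\<bar>"] fin by simp
    qed
    have "(\<lambda>c. map c [0..<T]) \<in> measurable (context_space P T) (count_space UNIV)"
      by (intro measurable_map_upt[where f = "\<lambda>s c. c s"] measurable_context_component)
    from measurable_compose[OF this, of F borel]
    show "(\<lambda>c. F (map c [0..<T])) \<in> borel_measurable (context_space P T)" by simp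
  qed
qed

text \<open>The product integral splits off the last coordinate whereas \<open>avgs\<close> recurses
  at the head; \<open>avgs_snoc\<close> reconciles the two.\<close>

lemma integral_context_space:
  assumes "cbb P"
  shows "(\<integral>c. F (map c [0..<T]) \<partial>context_space P T) = avgs P T F"
proof (induction T arbitrary: F)
  case 0
  interpret prob_space "context_space P 0" by (rule prob_space_context_space)
  show ?case by (simp add: prob_space)
next
  case (Suc T)
  interpret product_sigma_finite "\<lambda>_ :: nat. measure_pmf (context_law P)"
    by unfold_locales
  have "(\<integral>c. F (map c [0..<Suc T]) \<partial>context_space P (Suc T)) =
     (\<integral>c. \<integral>j. F (map (c(T := j)) [0..<Suc T]) \<partial>measure_pmf (context_law P) \<partial>context_space P T)"
    unfolding context_space_def lessThan_Suc
    using integrable_context_space[OF assms, of "Suc T" F]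
    by (intro product_integral_insert) (simp_all add: context_space_def lessThan_Suc)
  also have "\<dots> = (\<integral>c. avg P (\<lambda>j. F (map c [0..<T] @ [j])) \<partial>context_space P T)"
  proof (intro Bochner_Integration.integral_cong refl)
    fix c :: "nat \<Rightarrow> nat"
    have "map (c(T := j)) [0..<Suc T] = map c [0..<T] @ [j]" for j by simp
    then show "(\<integral>j. F (map (c(T := j)) [0..<Suc T]) \<partial>measure_pmf (context_law P))
      = avg P (\<lambda>j. F (map c [0..<T] @ [j]))" by (simp only: integral_context_law[OF assms])
  qed
  also have "\<dots> = avgs P (Suc T) F" unfolding avgs_snoc by (rule Suc.IH)
  finally show ?case .
qed

lemma clairvoyant_reward_eq: "cbb P \<Longrightarrow> clairvoyant_reward P T = clairvoyant_value P T"
  by (simp add: clairvoyant_reward_def clairvoyant_value_def Max_schedule_value integral_context_space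
      flip: integral_context_space)

text \<open>A non-integrable function has integral \<open>0\<close> by convention, which
  \<open>0 \<le> B\<close> covers. The bound thus applies to \<open>policy_gain\<close> without a
  measurability argument.\<close>

lemma (in prob_space) integral_le_nonneg_const:
  assumes "\<And>x. f x \<le> B" "0 \<le> (B :: real)"
  shows "integral\<^sup>L M f \<le> B"
  using assms by (cases "integrable M f") (auto intro: integral_le_const simp: not_integrable_integral_eq)

locale play =
  fixes \<pi> :: algorithm and P :: cbb and \<nu> :: "(nat \<times> nat \<Rightarrow> real) measure" and T :: nat
  assumes P: "cbb P" and \<nu>: "reward_law P \<nu>" and \<pi>: "online_algorithm \<pi>"
begin

abbreviation "rewards \<equiv> Pi\<^sub>M {..<T} (\<lambda>_. \<nu>)"
abbreviation "outcomes \<equiv> seeds \<Otimes>\<^sub>M (context_space P T \<Otimes>\<^sub>M rewards)"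

sublocale R: prob_space \<nu> using \<nu> by (simp add: reward_law_def)
sublocale U: prob_space seeds by (rule prob_space_seeds)
sublocale C: prob_space "context_space P T" by (rule prob_space_context_space)
sublocale X: prob_space rewards by (intro prob_space_PiM R.prob_space_axioms)
sublocale CX: pair_prob_space "context_space P T" rewards ..
sublocale UCX: pair_prob_space seeds "context_space P T \<Otimes>\<^sub>M rewards" ..

lemma measurable_context:
  "t < T \<Longrightarrow> (\<lambda>\<omega>. fst (snd \<omega>) t) \<in> measurable outcomes (count_space UNIV)"
  by (rule measurable_compose[OF _ measurable_context_component, where f = "\<lambda>\<omega>. fst (snd \<omega>)" and P1 = P]) simp_all

text \<open>\<open>k\<close> is an arbitrary pair because the later case split over the value of a
  context runs through all natural numbers.\<close>

lemma measurable_reward_component: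
  assumes "t < T"
  shows "(\<lambda>x. x t k) \<in> borel_measurable rewards"
proof -
  have "(\<lambda>v. v k) \<in> borel_measurable \<nu>"
  proof (cases "k \<in> arms P \<times> contexts P") \<comment> \<open>off the index set, points of the product are \<open>undefined\<close>\<close>
    case True
    then have "(\<lambda>v. v k) \<in> borel_measurable (Pi\<^sub>M (arms P \<times> contexts P) (\<lambda>_. borel))"
      by (rule measurable_component_singleton)
    then show ?thesis using \<nu> by (simp add: reward_law_def cong: measurable_cong_sets)
  next
    case False
    have sp: "space \<nu> = space (Pi\<^sub>M (arms P \<times> contexts P) (\<lambda>_. borel))"
      using \<nu> by (intro sets_eq_imp_space_eq) (simp add: reward_law_def)
    have "v k = undefined" if "v \<in> space \<nu>" for v
      using that False by (cases k) (auto simp: sp space_PiM PiE_def extensional_def)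
    then show ?thesis by (subst measurable_cong[of _ _ "\<lambda>_. undefined"]) simp_all
  qed
  moreover have "(\<lambda>x. x t) \<in> measurable rewards \<nu>"
    using assms by (intro measurable_component_singleton) simp
  ultimately show ?thesis by (rule measurable_compose[rotated])
qed

lemma measurable_reward:
  assumes "t < T"
  shows "(\<lambda>\<omega>. snd (snd \<omega>) t k) \<in> borel_measurable outcomes"
  by (rule measurable_compose[OF _ measurable_reward_component[OF assms], where f = "\<lambda>\<omega>. snd (snd \<omega>)"]) simp

text \<open>Past contexts and actions take countably many values and can be frozen one value at a
  time. The collected rewards are real and enter through the joint measurability demanded by
  \<open>online_algorithm\<close>.\<close>

lemma measurable_action:
  "t < T \<Longrightarrow> (\<lambda>\<omega>. action \<pi> P (fst \<omega>) (fst (snd \<omega>)) (snd (snd \<omega>)) t)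
     \<in> measurable outcomes (count_space UNIV)"
proof (induction t rule: less_induct)
  case (less t)
  define A where "A s \<omega> = action \<pi> P (fst \<omega>) (fst (snd \<omega>)) (snd (snd \<omega>)) s"
    for s and \<omega> :: "(nat \<Rightarrow> real) \<times> (nat \<Rightarrow> nat) \<times> (nat \<Rightarrow> nat \<times> nat \<Rightarrow> real)"
  define c where "c s \<omega> = fst (snd \<omega>) s"
    for s and \<omega> :: "(nat \<Rightarrow> real) \<times> (nat \<Rightarrow> nat) \<times> (nat \<Rightarrow> nat \<times> nat \<Rightarrow> real)"
  define Y where "Y s \<omega> = (case A s \<omega> of None \<Rightarrow> 0 | Some i \<Rightarrow> snd (snd \<omega>) s (i, c s \<omega>))" for s \<omega>
  have A: "A s \<in> measurable outcomes (count_space UNIV)" if "s < t" for s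
    unfolding A_def by (rule less.IH) (use less.prems that in auto)
  have c: "c s \<in> measurable outcomes (count_space UNIV)" if "s \<le> t" for s
    unfolding c_def by (rule measurable_context) (use less.prems that in auto)
  have Y: "Y s \<in> borel_measurable outcomes" if "s < t" for s
  proof -
    have "s < T" using that less by simp
    then have "(\<lambda>\<omega>. snd (snd \<omega>) s (i, c s \<omega>)) \<in> borel_measurable outcomes" for i
      using measurable_compose_countable[where g = "c s" and f = "\<lambda>k \<omega>. snd (snd \<omega>) s (i, k)"]
        measurable_reward c[of s] that by simp
    then have "(\<lambda>\<omega>. case a of None \<Rightarrow> 0 | Some i \<Rightarrow> snd (snd \<omega>) s (i, c s \<omega>)) \<in> borel_measurable outcomes" for a
      by (cases a) auto
    then show ?thesis unfolding Y_def by (rule measurable_compose_countable[where g = "A s", OF _ A[OF that]])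
  qed
  have step: "(\<lambda>\<omega>. \<pi> P (fst \<omega>) cs as (map (\<lambda>s. Y s \<omega>) [0..<t])) \<in> measurable outcomes (count_space UNIV)"
    for cs as
  proof -
    have "(\<lambda>\<omega>. (fst \<omega>, \<lambda>s\<in>{..<t}. Y s \<omega>)) \<in> measurable outcomes (seeds \<Otimes>\<^sub>M Pi\<^sub>M {..<t} (\<lambda>_. borel))"
      by (intro measurable_Pair measurable_restrict Y) simp_all
    moreover have "(\<lambda>(u, y). \<pi> P u cs as (map y [0..<t]))
        \<in> measurable (seeds \<Otimes>\<^sub>M Pi\<^sub>M {..<t} (\<lambda>_. borel)) (count_space UNIV)"
      using \<pi> P by (simp add: online_algorithm_def)
    ultimately have "(\<lambda>\<omega>. \<pi> P (fst \<omega>) cs as (map (\<lambda>s\<in>{..<t}. Y s \<omega>) [0..<t])) \<in> measurable outcomes (count_space UNIV)"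
      by (rule measurable_compose[THEN measurable_cong[THEN iffD1, rotated]]) simp
    moreover have "map (\<lambda>s\<in>{..<t}. Y s \<omega>) [0..<t] = map (\<lambda>s. Y s \<omega>) [0..<t]" for \<omega> by simp
    ultimately show ?thesis by simp
  qed
  have "(\<lambda>\<omega>. \<pi> P (fst \<omega>) (map (\<lambda>s. c s \<omega>) [0..<Suc t]) (map (\<lambda>s. A s \<omega>) [0..<t]) (map (\<lambda>s. Y s \<omega>) [0..<t]))
     \<in> measurable outcomes (count_space UNIV)"
    by (rule measurable_compose_countable[where g = "\<lambda>\<omega>. map (\<lambda>s. A s \<omega>) [0..<t]"],
        rule measurable_compose_countable[where g = "\<lambda>\<omega>. map (\<lambda>s. c s \<omega>) [0..<Suc t]"])
       (intro step measurable_map_upt A c; simp)+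
  moreover have "A t = (\<lambda>\<omega>. \<pi> P (fst \<omega>) (map (\<lambda>s. c s \<omega>) [0..<Suc t]) (map (\<lambda>s. A s \<omega>) [0..<t])
      (map (\<lambda>s. Y s \<omega>) [0..<t]))"
    unfolding A_def c_def Y_def by (rule ext, rule action_unfold)
  ultimately show ?case unfolding A_def[symmetric] by simp
qed

abbreviation "plays i j t \<omega> \<equiv>
  of_bool (action \<pi> P (fst \<omega>) (fst (snd \<omega>)) (snd (snd \<omega>)) t = Some i \<and> fst (snd \<omega>) t = j) :: real"

lemma measurable_plays:
  assumes "t < T"
  shows "plays i j t \<in> borel_measurable outcomes"
proof -
  have "(\<lambda>\<omega>. (action \<pi> P (fst \<omega>) (fst (snd \<omega>)) (snd (snd \<omega>)) t, fst (snd \<omega>) t)) \<in>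
      measurable outcomes (count_space UNIV \<Otimes>\<^sub>M count_space UNIV)"
    by (intro measurable_Pair measurable_action measurable_context assms)
  then have "(\<lambda>\<omega>. (action \<pi> P (fst \<omega>) (fst (snd \<omega>)) (snd (snd \<omega>)) t, fst (snd \<omega>) t)) \<in>
      measurable outcomes (count_space UNIV)"
    by (simp add: pair_measure_countable)
  from measurable_compose[OF this, of "\<lambda>(a, k). of_bool (a = Some i \<and> k = j)" borel]
  show ?thesis by simp
qed

lemma AE_reward:
  assumes "t < T" "i \<in> arms P" "j \<in> contexts P"
  shows "AE \<omega> in outcomes. snd (snd \<omega>) t (i, j) \<in> {0..1}"
proof -
  have "AE x in rewards. x t (i, j) \<in> {0..1}"
    using assms \<nu> by (intro AE_PiM_component[where P = "\<lambda>v. v (i, j) \<in> {0..1}"])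
      (auto simp: reward_law_def)
  then have "AE \<omega> in context_space P T \<Otimes>\<^sub>M rewards. snd \<omega> t (i, j) \<in> {0..1}"
    by (intro CX.AE_pair_measure measurable_sets_Collect[where P = "\<lambda>r. r \<in> {0..1}", OF
        measurable_compose[OF measurable_snd measurable_reward_component[OF assms(1)]]]) simp_all
  then show ?thesis
    by (intro UCX.AE_pair_measure measurable_sets_Collect[where P = "\<lambda>r. r \<in> {0..1}", OF
        measurable_reward[OF assms(1)]]) simp_all
qed

lemma integrable_reward_term:
  assumes "t < T" "i \<in> arms P" "j \<in> contexts P"
  shows "integrable outcomes (\<lambda>\<omega>. snd (snd \<omega>) t (i, j) * plays i j t \<omega>)"
proof (rule UCX.integrable_const_bound[where B = 1])
  show "AE \<omega> in outcomes. norm (snd (snd \<omega>) t (i, j) * plays i j t \<omega>) \<le> 1"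
    using AE_reward[OF assms] by eventually_elim auto
qed (rule borel_measurable_times[OF measurable_reward[OF assms(1)] measurable_plays[OF assms(1)]])

lemma integrable_mean_term:
  assumes "t < T"
  shows "integrable outcomes (\<lambda>\<omega>. mean_reward P i j * plays i j t \<omega>)"
  by (rule UCX.integrable_const_bound[where B = "\<bar>mean_reward P i j\<bar>",
        OF _ borel_measurable_times[OF borel_measurable_const measurable_plays[OF assms]]]) auto

end

lemma integral_sum_sum_sum:
  fixes h :: "'a \<Rightarrow> 'b \<Rightarrow> 'c \<Rightarrow> 'd \<Rightarrow> real"
  assumes "\<And>a b c. a \<in> A \<Longrightarrow> b \<in> B \<Longrightarrow> c \<in> C \<Longrightarrow> integrable M (h a b c)"
  shows "(\<integral>x. (\<Sum>a\<in>A. \<Sum>b\<in>B. \<Sum>c\<in>C. h a b c x) \<partial>M) = (\<Sum>a\<in>A. \<Sum>b\<in>B. \<Sum>c\<in>C. \<integral>x. h a b c x \<partial>M)"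
  using assms by (simp add: Bochner_Integration.integral_sum Bochner_Integration.integrable_sum)

context play begin

text \<open>
  The action in round \<open>t\<close> does not depend on the reward vector of that round, so integrating out this
  coordinate alone replaces the reward by its mean.
\<close>

lemma integral_reward_slice:
  assumes "t < T" "i \<in> arms P" "j \<in> contexts P"
    and f: "integrable rewards (\<lambda>x. x t (i, j) * plays i j t (u, c, x))"
    and g: "integrable rewards (\<lambda>x. mean_reward P i j * plays i j t (u, c, x))"
  shows "(\<integral>x. x t (i, j) * plays i j t (u, c, x) \<partial>rewards) =
    (\<integral>x. mean_reward P i j * plays i j t (u, c, x) \<partial>rewards)"
proof -
  interpret product_sigma_finite "\<lambda>_ :: nat. \<nu>" by unfold_locales
  define I where "I = {..<T} - {t}"
  have I: "finite I" "t \<notin> I" "{..<T} = insert t I" using assms(1) by (auto simp: I_def)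
  have upd: "plays i j t (u, c, x(t := y)) = plays i j t (u, c, x)" for x y
    using action_cong[of t c c "x(t := y)" x] by simp
  have "(\<integral>x. x t (i, j) * plays i j t (u, c, x) \<partial>rewards) =
     (\<integral>x. \<integral>y. (x(t := y)) t (i, j) * plays i j t (u, c, x(t := y)) \<partial>\<nu> \<partial>Pi\<^sub>M I (\<lambda>_. \<nu>))"
    unfolding I(3) by (rule product_integral_insert[OF I(1,2) f[unfolded I(3)]])
  also have "\<dots> = (\<integral>x. \<integral>y. mean_reward P i j * plays i j t (u, c, x(t := y)) \<partial>\<nu> \<partial>Pi\<^sub>M I (\<lambda>_. \<nu>))"
    unfolding upd using \<nu> assms by (simp add: reward_law_def R.prob_space)
  also have "\<dots> = (\<integral>x. mean_reward P i j * plays i j t (u, c, x) \<partial>rewards)"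
    unfolding I(3) by (rule product_integral_insert[OF I(1,2) g[unfolded I(3)], symmetric])
  finally show ?thesis .
qed

text \<open>Fubini twice. Slices are integrable only for almost every seed and almost every context
  sequence, so the slice identity is carried along almost everywhere.\<close>

lemma integral_reward_term:
  assumes "t < T" "i \<in> arms P" "j \<in> contexts P"
  shows "(\<integral>\<omega>. snd (snd \<omega>) t (i, j) * plays i j t \<omega> \<partial>outcomes) =
    (\<integral>\<omega>. mean_reward P i j * plays i j t \<omega> \<partial>outcomes)" (is "integral\<^sup>L _ ?f = integral\<^sup>L _ ?g")
proof -
  have f: "integrable outcomes ?f" and g: "integrable outcomes ?g"
    using integrable_reward_term integrable_mean_term assms by blast+
  have "AE u in seeds. (\<integral>y. ?f (u, y) \<partial>(context_space P T \<Otimes>\<^sub>M rewards)) =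
     (\<integral>y. ?g (u, y) \<partial>(context_space P T \<Otimes>\<^sub>M rewards))"
    using UCX.AE_integrable_fst'[OF f] UCX.AE_integrable_fst'[OF g]
  proof eventually_elim
    case (elim u)
    have "AE c in context_space P T. (\<integral>x. ?f (u, c, x) \<partial>rewards) = (\<integral>x. ?g (u, c, x) \<partial>rewards)"
      using CX.AE_integrable_fst'[OF elim(1)] CX.AE_integrable_fst'[OF elim(2)]
    proof eventually_elim
      case (elim c)
      then show ?case using integral_reward_slice[OF assms, of u c] by simp
    qed
    then have "(\<integral>c. \<integral>x. ?f (u, c, x) \<partial>rewards \<partial>context_space P T) =
        (\<integral>c. \<integral>x. ?g (u, c, x) \<partial>rewards \<partial>context_space P T)"
      using CX.integrable_fst'[OF elim(1)] CX.integrable_fst'[OF elim(2)]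
      by (intro integral_cong_AE borel_measurable_integrable)
    then show ?case using CX.integral_fst'[OF elim(1)] CX.integral_fst'[OF elim(2)] by simp
  qed
  then have "(\<integral>u. \<integral>y. ?f (u, y) \<partial>(context_space P T \<Otimes>\<^sub>M rewards) \<partial>seeds) =
     (\<integral>u. \<integral>y. ?g (u, y) \<partial>(context_space P T \<Otimes>\<^sub>M rewards) \<partial>seeds)"
    using UCX.integrable_fst'[OF f] UCX.integrable_fst'[OF g]
    by (intro integral_cong_AE borel_measurable_integrable)
  then show ?thesis unfolding UCX.integral_fst'[OF f] UCX.integral_fst'[OF g] .
qed

text \<open>
  For a fixed seed and fixed rewards the algorithm is a deterministic player in the above sense.
\<close>

definition policy :: "(nat \<Rightarrow> real) \<Rightarrow> (nat \<Rightarrow> nat \<times> nat \<Rightarrow> real) \<Rightarrow> nat list \<Rightarrow> nat option" where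
  "policy u x cs = action \<pi> P u (nth cs) x (length cs - 1)"

text \<open>\<open>nth\<close> past the end of a list is unspecified, but by
  \<open>action_cong\<close> only the first \<open>t + 1\<close> contexts matter.\<close>

lemma policy_take:
  assumes "t < length cs"
  shows "policy u x (take (Suc t) cs) = action \<pi> P u (nth cs) x t"
proof -
  have "length (take (Suc t) cs) - 1 = t" using assms by simp
  then show ?thesis unfolding policy_def by (auto intro: action_cong)
qed

lemma policy_history:
  "map (\<lambda>k. policy u x (take (Suc k) cs)) [0..<length cs - 1] =
     map (action \<pi> P u (nth cs) x) [0..<length cs - 1]"
  by (intro map_cong refl policy_take) auto

definition policy_gain :: "(nat \<Rightarrow> real) \<Rightarrow> (nat \<Rightarrow> nat \<times> nat \<Rightarrow> real) \<Rightarrow> real" where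
  "policy_gain u x = avgs P T (\<lambda>cs. \<Sum>t<T. mean_gain P (policy u x (take (Suc t) cs)) (cs ! t))"

text \<open>Each reward is first replaced by its mean; then the contexts are integrated innermost,
  with the seed and the rewards fixed.\<close>

lemma expected_reward_eq: "expected_reward \<pi> P \<nu> T = (\<integral>u. \<integral>x. policy_gain u x \<partial>rewards \<partial>seeds)"
proof -
  define G where "G \<omega> = (\<Sum>t<T. \<Sum>i\<in>arms P. \<Sum>j\<in>contexts P. mean_reward P i j * plays i j t \<omega>)" for \<omega>
  have "expected_reward \<pi> P \<nu> T =
     (\<integral>\<omega>. (\<Sum>t<T. \<Sum>i\<in>arms P. \<Sum>j\<in>contexts P. snd (snd \<omega>) t (i, j) * plays i j t \<omega>) \<partial>outcomes)"
    unfolding expected_reward_def by (intro Bochner_Integration.integral_cong refl) (simp split: prod.split)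
  also have "\<dots> = (\<Sum>t<T. \<Sum>i\<in>arms P. \<Sum>j\<in>contexts P. \<integral>\<omega>. snd (snd \<omega>) t (i, j) * plays i j t \<omega> \<partial>outcomes)"
    by (intro integral_sum_sum_sum integrable_reward_term) simp_all
  also have "\<dots> = (\<Sum>t<T. \<Sum>i\<in>arms P. \<Sum>j\<in>contexts P. \<integral>\<omega>. mean_reward P i j * plays i j t \<omega> \<partial>outcomes)"
    by (intro sum.cong refl integral_reward_term) auto
  also have "\<dots> = integral\<^sup>L outcomes G"
    unfolding G_def
    by (intro integral_sum_sum_sum[symmetric] integrable_mean_term) simp
  finally have E: "expected_reward \<pi> P \<nu> T = integral\<^sup>L outcomes G" .
  have G: "integrable outcomes G"
    unfolding G_def by (intro Bochner_Integration.integrable_sum integrable_mean_term) simp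
  \<comment> \<open>A uniform bound makes the slice of every seed integrable, not only of almost
    every one, so contexts and rewards can be swapped for each \<open>u\<close>.\<close>
  define B where "B = (\<Sum>t<T. \<Sum>i\<in>arms P. \<Sum>j\<in>contexts P. \<bar>mean_reward P i j\<bar>)"
  have B: "norm (G \<omega>) \<le> B" for \<omega>
    unfolding G_def B_def real_norm_def
    by (intro order_trans[OF sum_abs] sum_mono) (auto simp: abs_mult)
  have slice: "integrable (context_space P T \<Otimes>\<^sub>M rewards) (\<lambda>(c, x). G (u, c, x))" if "u \<in> space seeds" for u
    using measurable_compose[OF measurable_Pair1'[OF that] borel_measurable_integrable[OF G]] B
    by (intro CX.integrable_const_bound[where B = B]) auto
  have inner: "(\<integral>c. G (u, c, x) \<partial>context_space P T) = policy_gain u x" for u x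
  proof -
    define F where "F cs = (\<Sum>t<T. \<Sum>i\<in>arms P. \<Sum>j\<in>contexts P. mean_reward P i j *
        of_bool (policy u x (take (Suc t) cs) = Some i \<and> cs ! t = j))" for cs
    have "G (u, c, x) = F (map c [0..<T])" for c
    proof -
      have "action \<pi> P u c x t = policy u x (take (Suc t) (map c [0..<T]))" if "t < T" for t
        using that by (subst policy_take) (auto intro: action_cong)
      then show ?thesis unfolding G_def F_def by (intro sum.cong refl) auto
    qed
    then have "(\<integral>c. G (u, c, x) \<partial>context_space P T) = avgs P T F"
      by (simp add: integral_context_space[OF P])
    also have "\<dots> = policy_gain u x" unfolding policy_gain_def
    proof (rule avgs_cong)
      fix cs assume cs: "set cs \<subseteq> contexts P" "length cs = T"
      show "F cs = (\<Sum>t<T. mean_gain P (policy u x (take (Suc t) cs)) (cs ! t))"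
        unfolding F_def
      proof (intro sum.cong refl)
        fix t assume t: "t \<in> {..<T}"
        then have j: "cs ! t \<in> contexts P" using cs by (metis lessThan_iff nth_mem subsetD)
        \<comment> \<open>Feasibility puts the played arm into \<open>arms P\<close>, so the double
          sum picks out exactly its term.\<close>
        have "feasible_action P (map (action \<pi> P u (nth cs) x) [0..<t]) (policy u x (take (Suc t) cs))"
          using t cs by (simp add: policy_take action_feasible[OF \<pi> P])
        then have i: "policy u x (take (Suc t) cs) = Some i \<Longrightarrow> i \<in> arms P" for i
          by (simp add: feasible_action_def)
        have fin: "finite (arms P)" "finite (contexts P)" using P by (auto simp: cbb_def)
        show "(\<Sum>i\<in>arms P. \<Sum>j\<in>contexts P. mean_reward P i j *
            of_bool (policy u x (take (Suc t) cs) = Some i \<and> cs ! t = j)) =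
          mean_gain P (policy u x (take (Suc t) cs)) (cs ! t)"
        proof (cases "policy u x (take (Suc t) cs)")
          case (Some i)
          have "(\<Sum>i'\<in>arms P. \<Sum>j\<in>contexts P. mean_reward P i' j * of_bool (Some i = Some i' \<and> cs ! t = j))
             = (\<Sum>i'\<in>arms P. if i' = i then mean_reward P i (cs ! t) else 0)"
            using fin j by (intro sum.cong refl) (auto simp: of_bool_def if_distrib cong: if_cong)
          then show ?thesis using Some i[OF Some] fin by (simp add: mean_gain_def)
        qed (simp add: mean_gain_def)
      qed
    qed
    finally show ?thesis .
  qed
  have "integral\<^sup>L outcomes G = (\<integral>u. \<integral>y. G (u, y) \<partial>(context_space P T \<Otimes>\<^sub>M rewards) \<partial>seeds)"
    by (rule UCX.integral_fst'[OF G, symmetric])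
  also have "\<dots> = (\<integral>u. \<integral>x. policy_gain u x \<partial>rewards \<partial>seeds)"
  proof (intro Bochner_Integration.integral_cong refl)
    fix u assume "u \<in> space seeds"
    from CX.integral_snd[OF slice[OF this]]
    show "(\<integral>y. G (u, y) \<partial>(context_space P T \<Otimes>\<^sub>M rewards)) = (\<integral>x. policy_gain u x \<partial>rewards)"
      by (simp add: inner split_beta')
  qed
  finally show ?thesis using E by simp
qed

lemma expected_reward_le: "expected_reward \<pi> P \<nu> T \<le> online_value P T []"
proof -
  have "policy_gain u x \<le> online_value P T []" for u x
  proof -
    have "feasible_action P (map (\<lambda>k. policy u x (take (Suc k) cs)) [0..<length cs - 1]) (policy u x cs)" for cs
      unfolding policy_history by (simp add: policy_def action_feasible[OF \<pi> P])
    from policy_gain_le_online_value[where \<sigma> = "policy u x" and n = T and ds = "[]", OF P this]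
    show ?thesis by (simp add: policy_gain_def)
  qed
  then show ?thesis unfolding expected_reward_eq
    by (intro U.integral_le_nonneg_const X.integral_le_nonneg_const online_value_nonneg P)
qed

end

definition greedy_algorithm :: "nat \<Rightarrow> algorithm" where
  "greedy_algorithm T P u cs as ys = greedy P T as (last cs)"

lemma online_greedy_algorithm: "online_algorithm (greedy_algorithm T)"
  by (simp add: online_algorithm_def greedy_algorithm_def greedy_feasible)

lemma expected_reward_greedy:
  assumes "cbb P" "reward_law P \<nu>"
  shows "expected_reward (greedy_algorithm T) P \<nu> T = online_value P T []"
proof -
  interpret play "greedy_algorithm T" P \<nu> T
    using assms online_greedy_algorithm by unfold_locales
  have "policy_gain u x = online_value P T []" for u x
  proof -
    have "policy u x cs = greedy P T (map (\<lambda>k. policy u x (take (Suc k) cs)) [0..<length cs - 1]) (last cs)"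
      if "cs \<noteq> []" for cs
    proof -
      have "policy u x cs = greedy P T (map (action (greedy_algorithm T) P u (nth cs) x) [0..<length cs - 1])
          (last (map (nth cs) [0..<Suc (length cs - 1)]))"
        unfolding policy_def by (subst action_unfold) (simp only: greedy_algorithm_def)
      also have "map (nth cs) [0..<Suc (length cs - 1)] = cs"
        using that by (simp add: map_nth)
      finally show ?thesis unfolding policy_history .
    qed
    from greedy_policy_gain[where \<sigma> = "policy u x" and n = T and T = T and ds = "[]", OF assms(1) this]
    show ?thesis by (simp add: policy_gain_def)
  qed
  then show ?thesis by (simp add: expected_reward_eq X.prob_space U.prob_space)
qed

text \<open>Point mass at the means. It ensures that every \<open>P\<close> really occurs in the
  infimum over pairs.\<close>

lemma reward_law_exists:
  assumes "cbb P"
  shows "\<exists>\<nu>. reward_law P \<nu>"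
proof -
  let ?M = "Pi\<^sub>M (arms P \<times> contexts P) (\<lambda>_. borel :: real measure)"
  define v where "v = restrict (\<lambda>(i, j). mean_reward P i j) (arms P \<times> contexts P)"
  have v: "v \<in> space ?M" by (simp add: v_def space_PiM)
  have "reward_law P (return ?M v)"
    unfolding reward_law_def
  proof (intro conjI ballI)
    fix i j assume ij: "i \<in> arms P" "j \<in> contexts P"
    have m: "(\<lambda>v. v (i, j)) \<in> borel_measurable ?M"
      using ij by (intro measurable_component_singleton) simp
    have vij: "v (i, j) = mean_reward P i j" using ij by (simp add: v_def)
    show "AE v in return ?M v. v (i, j) \<in> {0..1}"
      using measurable_sets_Collect[OF m, of "\<lambda>r. r \<in> {0..1}"] v assms ij vij
      by (subst AE_return) (auto simp: pred_def cbb_def)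
    show "(\<integral>v. v (i, j) \<partial>return ?M v) = mean_reward P i j"
      using integral_return[OF v m] vij by simp
  qed (use v in \<open>simp_all add: prob_space_return\<close>)
  then show ?thesis by blast
qed

subsection \<open>Convergence and the limit\<close>

definition instances :: "nat \<Rightarrow> nat \<Rightarrow> cbb set" where
  "instances d T = {P. cbb P \<and> max_delay P = d \<and> 0 < clairvoyant_value P T}"

definition value_ratio :: "cbb \<Rightarrow> nat \<Rightarrow> real" where
  "value_ratio P T = online_value P T [] / clairvoyant_value P T"

text \<open>No algorithm beats the dynamic program on any instance, and since an algorithm is told
  \<open>P\<close>, the greedy one attains it on all instances at once.\<close>

lemma SUP_competitive_ratio:
  "(SUP \<pi>\<in>{\<pi>. online_algorithm \<pi>}. competitive_ratio d \<pi> T) =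
     (INF P\<in>instances d T. ereal (value_ratio P T))"
proof (rule antisym)
  show "(SUP \<pi>\<in>{\<pi>. online_algorithm \<pi>}. competitive_ratio d \<pi> T)
     \<le> (INF P\<in>instances d T. ereal (value_ratio P T))"
  proof (intro SUP_least INF_greatest)
    fix \<pi> P assume \<pi>: "\<pi> \<in> {\<pi>. online_algorithm \<pi>}" and inst: "P \<in> instances d T"
    then have c: "cbb P" by (simp add: instances_def)
    obtain \<nu> where \<nu>: "reward_law P \<nu>" using reward_law_exists[OF c] by blast
    interpret play \<pi> P \<nu> T using \<pi> c \<nu> by unfold_locales auto
    have "competitive_ratio d \<pi> T \<le> ereal (expected_reward \<pi> P \<nu> T / clairvoyant_reward P T)"
      unfolding competitive_ratio_def
      by (rule INF_lower2[of "(P, \<nu>)"]) (use c \<nu> inst in \<open>auto simp: instances_def clairvoyant_reward_eq\<close>)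
    also have "\<dots> \<le> ereal (value_ratio P T)"
      using expected_reward_le inst c
      by (auto simp: value_ratio_def clairvoyant_reward_eq instances_def intro: divide_right_mono)
    finally show "competitive_ratio d \<pi> T \<le> ereal (value_ratio P T)" .
  qed
next
  have "(INF P\<in>instances d T. ereal (value_ratio P T)) \<le> competitive_ratio d (greedy_algorithm T) T"
    unfolding competitive_ratio_def
    by (intro INF_greatest)
       (auto simp: expected_reward_greedy instances_def clairvoyant_reward_eq value_ratio_def intro!: INF_lower2)
  then show "(INF P\<in>instances d T. ereal (value_ratio P T))
     \<le> (SUP \<pi>\<in>{\<pi>. online_algorithm \<pi>}. competitive_ratio d \<pi> T)"
    by (intro SUP_upper2[of "greedy_algorithm T"]) (simp_all add: online_greedy_algorithm)
qed

text \<open>The factor \<open>\<kappa>\<close> of the outline, as produced by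
  \<open>value_ratio_bound\<close>.\<close>

definition concat_loss :: "nat \<Rightarrow> nat \<Rightarrow> nat \<Rightarrow> real" where
  "concat_loss d m N = (let L = m + (d - 1); n = N div L in
     n / (n + real (n * (d - 1) + L) / real (m div d)))"

text \<open>Dividing by the number \<open>n\<close> of blocks leaves \<open>L / n\<close>, which
  vanishes; the relative cost of the \<open>d - 1\<close> idle rounds per block remains.\<close>

lemma concat_loss_tendsto:
  assumes "1 \<le> d" "d \<le> m"
  shows "concat_loss d m \<longlonglongrightarrow> 1 / (1 + real (d - 1) / real (m div d))"
proof -
  define L where "L = m + (d - 1)"
  have L: "0 < L" using assms by (simp add: L_def)
  have lim: "filterlim (\<lambda>N. N div L) sequentially sequentially"
    using L by (rule filterlim_at_top_div_const_nat)
  have k: "0 < real (m div d)" using assms by (simp add: div_greater_zero_iff)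
  have "(\<lambda>n. 1 / (1 + (real (d - 1) + real L / real n) / real (m div d))) \<longlonglongrightarrow> 1 / (1 + (real (d - 1) + 0) / real (m div d))"
    by (intro tendsto_intros lim_const_over_n) (use k in \<open>auto simp: add_pos_nonneg less_imp_neq[symmetric] add_nonneg_eq_0_iff\<close>)
  moreover have "eventually (\<lambda>n. 1 / (1 + (real (d - 1) + real L / real n) / real (m div d)) =
      n / (n + real (n * (d - 1) + L) / real (m div d))) sequentially"
    using eventually_gt_at_top[of 0]
  proof eventually_elim
    case (elim n)
    have "n + real (n * (d - 1) + L) / real (m div d) = n * (1 + (real (d - 1) + real L / real n) / real (m div d))"
      using elim k by (simp add: field_simps)
    then show ?case using elim by simp
  qed
  ultimately have "(\<lambda>n. n / (n + real (n * (d - 1) + L) / real (m div d))) \<longlonglongrightarrow> 1 / (1 + (real (d - 1) + 0) / real (m div d))"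
    by (rule Lim_transform_eventually)
  note filterlim_compose[OF this lim]
  moreover have "concat_loss d m =
      (\<lambda>N. real (N div L) / (real (N div L) + real (N div L * (d - 1) + L) / real (m div d)))"
    by (rule ext) (simp add: concat_loss_def L_def Let_def)
  ultimately show ?thesis by (simp only: add_0_right)
qed

lemma concat_loss_limit_tendsto:
  assumes "1 \<le> d"
  shows "(\<lambda>m. 1 / (1 + real (d - 1) / real (m div d))) \<longlonglongrightarrow> 1"
proof -
  have "filterlim (\<lambda>m. m div d) sequentially sequentially"
    using assms by (intro filterlim_at_top_div_const_nat) simp
  then have "(\<lambda>m. real (d - 1) / real (m div d)) \<longlonglongrightarrow> 0"
    using lim_const_over_n[of "real (d - 1)"] by (rule filterlim_compose[rotated])
  then have "(\<lambda>m. 1 / (1 + real (d - 1) / real (m div d))) \<longlonglongrightarrow> 1 / (1 + 0)"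
    by (intro tendsto_intros) auto
  then show ?thesis by simp
qed

text \<open>Letting \<open>N\<close> grow bounds \<open>\<kappa>' m * s m\<close> by the lower limit
  of \<open>s\<close>; letting \<open>m\<close> grow then brings the upper limit below the lower
  one.\<close>

lemma convergent_if_almost_superadditive:
  fixes s :: "nat \<Rightarrow> ereal" and \<kappa> :: "nat \<Rightarrow> nat \<Rightarrow> real"
  assumes bounds: "\<And>m. m \<ge> m0 \<Longrightarrow> 0 \<le> s m" "\<And>m. m \<ge> m0 \<Longrightarrow> s m \<le> 1"
    and le: "\<And>m N. m \<ge> m0 \<Longrightarrow> ereal (\<kappa> m N) * s m \<le> s N"
    and lim: "\<And>m. m \<ge> m0 \<Longrightarrow> \<kappa> m \<longlonglongrightarrow> \<kappa>' m"
    and \<kappa>': "\<kappa>' \<longlonglongrightarrow> 1" "\<And>m. m \<ge> m0 \<Longrightarrow> \<kappa>' m \<le> 1"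
  shows "convergent s"
proof -
  define l where "l = liminf s"
  \<comment> \<open>The multiplicative loss is made additive by \<open>s m \<le> 1\<close>, so that
    the passage to the upper limit needs only a sum.\<close>
  have s: "s m \<le> l + ereal (1 - \<kappa>' m)" if m: "m \<ge> m0" for m
  proof -
    obtain r where r: "s m = ereal r" "0 \<le> r" "r \<le> 1"
      using bounds[OF m] by (cases "s m") (auto simp: one_ereal_def)
    have "(\<lambda>N. ereal (\<kappa> m N * r)) \<longlonglongrightarrow> ereal (\<kappa>' m * r)"
      by (intro tendsto_intros lim m)
    then have "ereal (\<kappa>' m * r) = liminf (\<lambda>N. ereal (\<kappa> m N * r))"
      by (metis lim_imp_Liminf sequentially_bot)
    also have "\<dots> \<le> l"
      unfolding l_def using le[OF m] r by (intro Liminf_mono always_eventually) auto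
    finally have "ereal (\<kappa>' m * r) \<le> l" .
    moreover have "r \<le> \<kappa>' m * r + (1 - \<kappa>' m)"
      using mult_right_mono[OF r(3), of "1 - \<kappa>' m"] \<kappa>'(2)[OF m] by (simp add: algebra_simps)
    ultimately have "ereal r \<le> ereal (\<kappa>' m * r) + ereal (1 - \<kappa>' m)" by simp
    also have "\<dots> \<le> l + ereal (1 - \<kappa>' m)" using \<open>ereal (\<kappa>' m * r) \<le> l\<close> by (intro add_right_mono)
    finally show ?thesis by (simp add: r)
  qed
  have l: "0 \<le> l" unfolding l_def
    by (rule Liminf_bounded) (use bounds(1) in \<open>auto simp: eventually_at_top_linorder\<close>)
  have "(\<lambda>m. l + ereal (1 - \<kappa>' m)) \<longlonglongrightarrow> l + ereal (1 - 1)"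
    using l by (intro tendsto_add_ereal_general tendsto_intros \<kappa>') auto
  then have "limsup (\<lambda>m. l + ereal (1 - \<kappa>' m)) = l + ereal (1 - 1)"
    by (rule lim_imp_Limsup[OF sequentially_bot])
  moreover have "limsup s \<le> limsup (\<lambda>m. l + ereal (1 - \<kappa>' m))"
    by (rule Limsup_mono) (use s in \<open>auto simp: eventually_at_top_linorder\<close>)
  ultimately have "limsup s \<le> l" by (simp add: zero_ereal_def[symmetric])
  then have "s \<longlonglongrightarrow> l"
    using Liminf_le_Limsup[OF sequentially_bot, of s]
    unfolding l_def by (intro Liminf_eq_Limsup) (auto intro: antisym)
  then show ?thesis by (rule convergentI)
qed

theorem theorem3:
  fixes d :: nat
  assumes "1 \<le> d"
  shows "convergent (\<lambda>T. SUP \<pi>\<in>{\<pi>. online_algorithm \<pi>}. competitive_ratio d \<pi> T) \<and>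
         lim (\<lambda>T. SUP \<pi>\<in>{\<pi>. online_algorithm \<pi>}. competitive_ratio d \<pi> T)
           \<le> ereal (real d / (2 * real d - 1))"
proof -
  define s where "s T = (INF P\<in>instances d T. ereal (value_ratio P T))" for T
  \<comment> \<open>The class of instances is nonempty from \<open>2 * d\<close> on. Hence this
    threshold in the convergence argument: an infimum over the empty class would be
    infinite.\<close>
  have hard: "hard_instance d (1 / T\<^sup>2) \<in> instances d T" if "2 * d \<le> T" for T
    using hard_instance_ratio[OF assms that] by (simp add: instances_def)
  have conv: "convergent s"
  proof (rule convergent_if_almost_superadditive)
    fix m assume m: "m \<ge> 2 * d"
    then have "d \<le> m" by simp
    show "0 \<le> s m"
      unfolding s_def by (intro INF_greatest)
        (auto simp: value_ratio_def instances_def intro!: divide_nonneg_pos online_value_nonneg)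
    have "value_ratio P m \<le> 1" if "P \<in> instances d m" for P
      using that online_le_clairvoyant[of P m] by (simp add: value_ratio_def instances_def)
    then show "s m \<le> 1"
      unfolding s_def by (intro INF_lower2[OF hard[OF m]]) (simp add: hard[OF m])
    show "concat_loss d m \<longlonglongrightarrow> 1 / (1 + real (d - 1) / real (m div d))"
      by (rule concat_loss_tendsto) fact+
    have "0 \<le> real (d - 1) / real (m div d)" by simp
    then show "1 / (1 + real (d - 1) / real (m div d)) \<le> 1"
      by (subst divide_le_eq_1_pos) linarith+
    show "ereal (concat_loss d m N) * s m \<le> s N" for N
      unfolding s_def[of N]
    proof (intro INF_greatest)
      fix P assume "P \<in> instances d N"
      then have P: "cbb P" "max_delay P = d" "0 < clairvoyant_value P N" by (simp_all add: instances_def)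
      note b = value_ratio_bound[OF P(1,2) assms \<open>d \<le> m\<close> P(3)]
      \<comment> \<open>An instance with positive clairvoyant value at \<open>N\<close> also has one
        at \<open>m\<close>, so it competes in the infimum defining \<open>s m\<close>.\<close>
      have "s m \<le> ereal (value_ratio P m)"
        unfolding s_def by (rule INF_lower) (use P b in \<open>simp add: instances_def\<close>)
      then have "ereal (concat_loss d m N) * s m \<le> ereal (concat_loss d m N) * ereal (value_ratio P m)"
        by (intro ereal_mult_left_mono) (simp_all add: concat_loss_def Let_def)
      also have "\<dots> \<le> ereal (value_ratio P N)"
        using b(2) by (simp add: concat_loss_def Let_def value_ratio_def)
      finally show "ereal (concat_loss d m N) * s m \<le> ereal (value_ratio P N)" .
    qed
  qed (rule concat_loss_limit_tendsto[OF assms])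
  then have "s \<longlonglongrightarrow> lim s" by (simp add: convergent_LIMSEQ_iff)
  moreover have "(\<lambda>T. ereal (ratio_bound d T)) \<longlonglongrightarrow> ereal (real d / (2 * real d - 1))"
    by (intro tendsto_intros ratio_bound_tendsto assms)
  moreover have "s T \<le> ereal (ratio_bound d T)" if "T \<ge> 2 * d" for T
    unfolding s_def
    by (rule INF_lower2[OF hard[OF that]])
       (use hard_instance_ratio(3)[OF assms that] in \<open>simp add: value_ratio_def\<close>)
  ultimately have "lim s \<le> ereal (real d / (2 * real d - 1))"
    by (intro LIMSEQ_le) blast+
  then show ?thesis using conv unfolding SUP_competitive_ratio s_def by simp
qed

end
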